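(* Let $\mathbf{z}=(z_n)$ be a sequence in $\mathbb{D}$ that is regular with respect to a nonprincipal ultrafilter $\mathfrak{u}$ in $\mathbb{N}$. Then there exists a compact and connected subset $A \subset \mathfrak{M}$, linearly ordered by the pointwise order $\le$, with $\delta_{\mathbf{z},\mathfrak{u}} = \min A$ and $\|\cdot\| = \max A$, such that $\ker\varphi$ is a nonzero nonmaximal ideal of $H^\infty$ for all $\varphi \in A\setminus\{\delta_{\mathbf{z},\mathfrak{u}}, \|\cdot\|\}$.
   Context: $\mathbb{K}$ is an algebraically closed field, complete with respect to a nontrivial nonarchimedean absolute value $|\cdot|$; $\mathbb{D} = \{z \in \mathbb{K} : |z|<1\}$; $\mathbb{N}=\{1,2,\dots\}$. $H^\infty$ is the Banach $\mathbb{K}$-algebra of bounded power series $f(z)=\sum_{n\ge 0} a_n z^n$ on $\mathbb{D}$, with norm $\|f\| = \sup_n |a_n| = \sup_{z\in\mathbb{D}}|f(z)|$. $\mathfrak{M}$ is the Berkovich space of $H^\infty$: the set of all maps $\varphi: H^\infty \to [0,\infty)$ with $\varphi(0)=0$, $\varphi(1)=1$, $\varphi(fg)=\varphi(f)\varphi(g)$, $\varphi(f+g)\le \varphi(f)+\varphi(g)$ and $\varphi(f)\le\|f\|$, with the topology of pointwise convergence (it is compact Hausdorff). $\ker\varphi = \{f : \varphi(f)=0\}$. For $z\in\mathbb{D}$, $\delta_z(f):=|f(z)|$, and $\delta_{\mathbf{z},\mathfrak{u}} := \lim_{\mathfrak{u}}\delta_{z_n}$ (pointwise limit along $\mathfrak{u}$).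 A sequence $(z_n)$ in $\mathbb{D}$ is regular with respect to a nonprincipal ultrafilter $\mathfrak{u}$ in $\mathbb{N}$ if there is $C\in\mathfrak{u}$ with $\inf_{n\in C}\prod_{m\in C, m\ne n}|z_n-z_m|>0$. *)

theory Defs
  imports "HOL-Analysis.Analysis" "HOL-Algebra.Ideal"
begin

section \<open>Complete nonarchimedean fields\<close>

definition av_dist :: "('a::field \<Rightarrow> real) \<Rightarrow> 'a \<Rightarrow> 'a \<Rightarrow> real" where
  "av_dist av x y = av (x - y)"

locale complete_nonarch_field =
  fixes av :: "'a::field \<Rightarrow> real"
  assumes av_nonneg: "0 \<le> av x"
    and av_eq_0_iff: "av x = 0 \<longleftrightarrow> x = 0"
    and av_mult: "av (x * y) = av x * av y"
    and av_ultrametric: "av (x + y) \<le> max (av x) (av y)"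
    and av_nontrivial: "\<exists>x. x \<noteq> 0 \<and> av x \<noteq> 1"
    and av_complete: "Metric_space.mcomplete UNIV (av_dist av)"

definition unit_disc :: "('a::field \<Rightarrow> real) \<Rightarrow> 'a set" where
  "unit_disc av = {z. av z < 1}"


section \<open>The algebra of bounded power series\<close>

text \<open>
  A bounded power series is represented by its formal power series; since
  the supremum of \<open>|f|\<close> over the disc is the supremum of the coefficients of \<open>f\<close>,
  boundedness is imposed on the coefficients.
\<close>

definition Hinf :: "('a::field \<Rightarrow> real) \<Rightarrow> 'a fps set" where
  "Hinf av = {f. bdd_above (range (\<lambda>n. av (fps_nth f n)))}"

definition Hinf_ring :: "('a::field \<Rightarrow> real) \<Rightarrow> 'a fps ring" where
  "Hinf_ring av = \<lparr>carrier = Hinf av, mult = (*), one = 1, zero = 0, add = (+)\<rparr>"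

text \<open>The value of a power series at a point: the sum of the series in the metric of \<open>av\<close>.\<close>

definition eval_at :: "('a::field \<Rightarrow> real) \<Rightarrow> 'a fps \<Rightarrow> 'a \<Rightarrow> 'a" where
  "eval_at av f z =
     (THE w. limitin (Metric_space.mtopology UNIV (av_dist av))
               (\<lambda>N. \<Sum>n<N. fps_nth f n * z ^ n) w sequentially)"


section \<open>The Berkovich space\<close>

text \<open>
  Maps on \<open>Hinf av\<close> are total functions with the fixed value \<open>undefined\<close> outside
  \<open>Hinf av\<close>, so that they are determined by their values on \<open>Hinf av\<close>.
  In particular the library order \<open>\<le>\<close> on functions is, between such maps, the pointwise
  order on \<open>Hinf av\<close>.
\<close>

definition Hinf_norm :: "('a::field \<Rightarrow> real) \<Rightarrow> 'a fps \<Rightarrow> real" where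
  "Hinf_norm av = (\<lambda>f\<in>Hinf av. SUP n. av (fps_nth f n))"

definition Berkovich :: "('a::field \<Rightarrow> real) \<Rightarrow> ('a fps \<Rightarrow> real) set" where
  "Berkovich av = {\<phi> \<in> Hinf av \<rightarrow>\<^sub>E {0..}.
     \<phi> 0 = 0 \<and> \<phi> 1 = 1 \<and>
     (\<forall>f\<in>Hinf av. \<forall>g\<in>Hinf av. \<phi> (f * g) = \<phi> f * \<phi> g) \<and>
     (\<forall>f\<in>Hinf av. \<forall>g\<in>Hinf av. \<phi> (f + g) \<le> \<phi> f + \<phi> g) \<and>
     (\<forall>f\<in>Hinf av. \<phi> f \<le> Hinf_norm av f)}"

text \<open>The topology of pointwise convergence on \<open>Hinf av\<close>.\<close>

definition Berkovich_topology :: "('a::field \<Rightarrow> real) \<Rightarrow> ('a fps \<Rightarrow> real) topology" where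
  "Berkovich_topology av =
     subtopology (product_topology (\<lambda>_. euclideanreal) (Hinf av)) (Berkovich av)"

definition seminorm_ker :: "('a::field \<Rightarrow> real) \<Rightarrow> ('a fps \<Rightarrow> real) \<Rightarrow> 'a fps set" where
  "seminorm_ker av \<phi> = {f \<in> Hinf av. \<phi> f = 0}"

definition delta :: "('a::field \<Rightarrow> real) \<Rightarrow> 'a \<Rightarrow> 'a fps \<Rightarrow> real" where
  "delta av z = (\<lambda>f\<in>Hinf av. av (eval_at av f z))"


section \<open>Ultrafilters and regular sequences\<close>

text \<open>
  A set \<open>C\<close> belongs to the set-theoretic filter given by \<open>U\<close> iff
  \<open>eventually (\<lambda>n. n \<in> C) U\<close>. The index set is the type \<open>nat\<close>, i.e. sequences start at \<open>0\<close>.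
\<close>

definition nonprincipal_ultrafilter :: "nat filter \<Rightarrow> bool" where
  "nonprincipal_ultrafilter U \<longleftrightarrow>
     U \<noteq> bot \<and>
     (\<forall>C. eventually (\<lambda>n. n \<in> C) U \<or> eventually (\<lambda>n. n \<in> - C) U) \<and>
     (\<forall>n. U \<noteq> principal {n})"

definition delta_ultra :: "('a::field \<Rightarrow> real) \<Rightarrow> (nat \<Rightarrow> 'a) \<Rightarrow> nat filter \<Rightarrow> 'a fps \<Rightarrow> real" where
  "delta_ultra av z U = (\<lambda>f\<in>Hinf av. Lim U (\<lambda>n. delta av (z n) f))"

text \<open>
  The product over all \<open>m \<in> C\<close> with \<open>m \<noteq> n\<close> is the limit of its partial products, which are
  decreasing when the \<open>z m\<close> lie in the unit disc. The library's \<open>prodinf\<close> is not suitable,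
  since it is unspecified for products diverging to \<open>0\<close>.
\<close>

definition separation_prod :: "('a::field \<Rightarrow> real) \<Rightarrow> (nat \<Rightarrow> 'a) \<Rightarrow> nat set \<Rightarrow> nat \<Rightarrow> real" where
  "separation_prod av z C n =
     lim (\<lambda>N. \<Prod>m\<in>{m\<in>C. m \<noteq> n \<and> m < N}. av (z n - z m))"

definition regular_seq :: "('a::field \<Rightarrow> real) \<Rightarrow> (nat \<Rightarrow> 'a) \<Rightarrow> nat filter \<Rightarrow> bool" where
  "regular_seq av z U \<longleftrightarrow>
     (\<exists>C. eventually (\<lambda>n. n \<in> C) U \<and> 0 < (INF n\<in>C. separation_prod av z C n))"

end

theory Submission
  imports Defs
begin

text \<open>
  For \<open>\<bar>a\<bar> < 1\<close> and \<open>0 \<le> r < 1\<close> let \<open>zeta a r f\<close> be the supremum norm of \<open>f\<close> on the disc of radius \<open>r\<close>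
  about \<open>a\<close>.  The map \<open>r \<mapsto> zeta a r\<close> is a continuous increasing path of multiplicative seminorms that
  starts at \<open>delta a\<close> and tends to the Gauss norm.  The set \<open>chain\<close> is the limit, along the
  ultrafilter, of the paths at the points \<open>z n\<close>: a seminorm belongs to it if
  each of its neighbourhoods meets the path at \<open>z n\<close> for almost all \<open>n\<close>.  The limit set of connected
  sets in a compact Hausdorff space is compact and connected (\<open>connectedin_ultralimit\<close>).  It is
  linearly ordered because two of its elements can be approximated at a common \<open>z n\<close>, on a path
  that is itself linearly ordered.  It contains the limits of both ends of the paths.

  Let \<open>\<phi>\<close> be an element of the chain other than its minimum \<open>\<delta>\<close>.  Its kernel is contained in the kernel
  of \<open>\<delta>\<close>, and it is not maximal because the inclusion is proper.  A witness is a bounded \<open>B\<close> that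
  vanishes at almost all \<open>z n\<close> and satisfies \<open>r * c \<le> zeta (z n) r B\<close> for a constant \<open>c > 0\<close>
  (\<open>ex_vanishing_function\<close>): if \<open>\<phi> B = 0\<close>, the radii of the discs approximating \<open>\<phi>\<close> tend to \<open>0\<close>, and
  since \<open>zeta (z n) r f\<close> is Lipschitz in \<open>r\<close> uniformly in \<open>n\<close>, this means \<open>\<phi> = \<delta>\<close>.

  Let \<open>\<phi>\<close> be different from the maximum.  Then \<open>\<phi> f < \<eta> < \<parallel>f\<parallel>\<close> for some \<open>f\<close> and \<open>\<eta>\<close>.  The norm of \<open>f\<close> on the
  circle through \<open>z n\<close> tends to \<open>\<parallel>f\<parallel>\<close> as \<open>\<bar>z n\<bar>\<close> tends to \<open>1\<close>.  That \<open>f\<close> is smaller by a fixed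
  factor on a disc about \<open>z n\<close> can therefore only be due to the zeros of \<open>f\<close> on this circle: the
  product of their linear factors is smaller there by a fixed factor, too.  Raising the factors belonging to the
  circle to a power that grows slowly with \<open>n\<close>, one obtains a bounded \<open>g \<noteq> 0\<close> with \<open>\<phi> g = 0\<close>
  (\<open>ex_decaying_function\<close>).

  Both functions are infinite products.  A linear factor \<open>1 - X / w\<close> with \<open>\<bar>w\<bar>\<close> near \<open>1\<close> is not
  coefficientwise close to \<open>1\<close>, so that products of such factors do not converge.  Each factor is
  therefore multiplied by an auxiliary polynomial that makes it agree with \<open>1\<close> up to a degree \<open>m n\<close>
  tending to infinity.  This is compatible with boundedness, because a convergent series
  \<open>\<Sum>n. x n\<close> of nonnegative numbers remains convergent with weights \<open>(m n)\<^sup>2\<close> that tend to infinity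
  slowly enough.  The power series never have to be factored: their values on discs are limits of those
  of polynomials, and polynomials split into linear factors.
\<close>


section \<open>Inequalities and series of real numbers\<close>

lemma mult_less_le_imp_less_nonneg:
  fixes a b c d :: real
  assumes "a < b" "c \<le> d" "0 \<le> c" "0 \<le> a" "0 < d"
  shows "a * c < b * d"
  using assms by (metis mult_le_less_imp_less mult_left_mono mult_strict_right_mono order_le_less_trans)

lemma prod_mset_mono_real:
  fixes f g :: "'b \<Rightarrow> real"
  assumes "\<And>w. w \<in># W \<Longrightarrow> 0 \<le> f w" "\<And>w. w \<in># W \<Longrightarrow> f w \<le> g w"
  shows "(\<Prod>w\<in>#W. f w) \<le> (\<Prod>w\<in>#W. g w)"
proof -
  have "0 \<le> (\<Prod>w\<in>#W. f w) \<and> (\<Prod>w\<in>#W. f w) \<le> (\<Prod>w\<in>#W. g w)"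
    using assms
  proof (induction W)
    case (add w W)
    then have "0 \<le> f w" "f w \<le> g w" "0 \<le> (\<Prod>w\<in>#W. f w)" "(\<Prod>w\<in>#W. f w) \<le> (\<Prod>w\<in>#W. g w)"
      by auto
    then show ?case by (auto intro!: mult_mono mult_nonneg_nonneg)
  qed simp
  then show ?thesis ..
qed

lemma prod_mset_filter_if:
  "(\<Prod>w\<in>#filter_mset P W. g w :: real) = (\<Prod>w\<in>#W. if P w then g w else 1)"
  by (induction W) auto

lemma prod_antimono_subset:
  fixes f :: "'b \<Rightarrow> real"
  assumes "finite B" "A \<subseteq> B" "\<And>x. x \<in> B \<Longrightarrow> 0 \<le> f x" "\<And>x. x \<in> B \<Longrightarrow> f x \<le> 1"
  shows "prod f B \<le> prod f A"
proof -
  have "prod f B = prod f (B - A) * prod f A" using assms by (intro prod.subset_diff)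
  also have "\<dots> \<le> 1 * prod f A"
    using assms by (intro mult_right_mono prod_le_1 prod_nonneg) auto
  finally show ?thesis by simp
qed

lemma extensional_leI:
  fixes \<phi> \<psi> :: "'b \<Rightarrow> 'c::order"
  assumes "\<phi> \<in> extensional S" "\<psi> \<in> extensional S" "\<And>f. f \<in> S \<Longrightarrow> \<phi> f \<le> \<psi> f"
  shows "\<phi> \<le> \<psi>"
  using assms by (auto simp: le_fun_def extensional_def) (metis order_refl)

text \<open>If \<open>t n\<close> denotes the tails of the series, the terms \<open>x n / sqrt (t n)\<close> are bounded by the telescoping
  differences of \<open>2 * sqrt (t n)\<close>; so \<open>(m n)\<^sup>2\<close> may be as large as \<open>1 / sqrt (t n)\<close>.\<close>

lemma summable_slow_weights:
  fixes x :: "nat \<Rightarrow> real"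
  assumes nonneg: "\<And>n. 0 \<le> x n" and sum: "summable x"
  shows "\<exists>m::nat \<Rightarrow> nat. filterlim m at_top sequentially \<and> summable (\<lambda>n. real (m n)^2 * x n)"
proof -
  \<comment> \<open>The geometric series makes all tails positive.\<close>
  define y where "y n = x n + (1/2)^n" for n
  have y: "summable y" unfolding y_def
    using sum by (intro summable_add summable_geometric) auto
  have ypos: "0 < y n" for n
    using nonneg[of n] by (simp add: y_def add_nonneg_pos)
  define t where "t n = (\<Sum>k. y (k + n))" for n
  have ysum: "summable (\<lambda>k. y (k + n))" for n using y by (rule summable_ignore_initial_segment)
  have tpos: "0 < t n" for n unfolding t_def using ysum ypos by (intro suminf_pos) auto
  have step: "t n = y n + t (Suc n)" for n
    using suminf_split_head[OF ysum[of n]] by (simp add: t_def)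
  have t0: "t \<longlonglongrightarrow> 0"
    unfolding t_def using suminf_exist_split2[OF y] by simp
  define s where "s n = sqrt (t n)" for n
  have s: "0 < s n" for n using tpos by (simp add: s_def)
  have s0: "s \<longlonglongrightarrow> 0" unfolding s_def using tendsto_real_sqrt[OF t0] by simp
  have s_dec: "s (Suc n) \<le> s n" for n
    using step[of n] ypos[of n] by (simp add: s_def)
  define m where "m n = nat \<lfloor>sqrt (1 / s n)\<rfloor>" for n
  have m_le: "real (m n) ^ 2 \<le> 1 / s n" for n
  proof -
    have "real (m n) \<le> sqrt (1 / s n)" using s[of n] by (simp add: m_def of_nat_floor)
    then have "real (m n) ^ 2 \<le> (sqrt (1 / s n)) ^ 2" by (intro power_mono) auto
    then show ?thesis using s[of n] by simp
  qed
  have "filterlim (\<lambda>n. inverse (s n)) at_top sequentially"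
    using s0 s by (intro filterlim_inverse_at_top) auto
  then have "filterlim (\<lambda>n. sqrt (1 / s n)) at_top sequentially"
    by (intro filterlim_compose[OF sqrt_at_top]) (simp add: inverse_eq_divide)
  then have "filterlim m at_top sequentially"
    unfolding m_def
    by (intro filterlim_compose[OF filterlim_nat_sequentially] filterlim_compose[OF filterlim_floor_sequentially])
  moreover have "summable (\<lambda>n. real (m n)^2 * x n)"
  proof (rule summable_comparison_test')
    show "summable (\<lambda>n. 2 * (s n - s (Suc n)))"
      by (intro summable_mult telescope_summable'[OF s0])
    fix n
    have "real (m n)^2 * x n \<le> 1 / s n * y n"
      using m_le nonneg by (intro mult_mono) (auto simp: y_def less_imp_le[OF s])
    also have "\<dots> = (s n ^ 2 - s (Suc n) ^ 2) / s n"
      using step[of n] tpos[of n] tpos[of "Suc n"] by (simp add: s_def less_imp_le)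
    also have "\<dots> = (s n - s (Suc n)) * ((s n + s (Suc n)) / s n)"
      by (simp add: power2_eq_square algebra_simps)
    also have "\<dots> \<le> (s n - s (Suc n)) * 2"
      using s_dec[of n] s[of n] by (intro mult_left_mono) (auto simp: field_simps)
    finally show "norm (real (m n)^2 * x n) \<le> 2 * (s n - s (Suc n))"
      using nonneg[of n] by simp
  qed
  ultimately show ?thesis by blast
qed

lemma prod_le_exp_suminf:
  fixes f x :: "nat \<Rightarrow> real"
  assumes "\<And>n. 0 \<le> f n" "\<And>n. f n \<le> exp (x n)" "\<And>n. 0 \<le> x n" "summable x" "finite J"
  shows "(\<Prod>n\<in>J. f n) \<le> exp (\<Sum>n. x n)"
proof -
  have "(\<Prod>n\<in>J. f n) \<le> (\<Prod>n\<in>J. exp (x n))" using assms by (intro prod_mono) auto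
  also have "\<dots> = exp (\<Sum>n\<in>J. x n)" using assms(5) by (simp add: exp_sum)
  also have "\<dots> \<le> exp (\<Sum>n. x n)" using assms by (simp add: sum_le_suminf)
  finally show ?thesis .
qed


section \<open>Limits of connected sets along an ultrafilter\<close>

lemma nonprincipal_ultrafilterD:
  assumes "nonprincipal_ultrafilter U"
  shows "U \<noteq> bot" and "eventually P U \<or> eventually (\<lambda>n. \<not> P n) U"
proof -
  show "U \<noteq> bot" using assms by (simp add: nonprincipal_ultrafilter_def)
  have "eventually (\<lambda>n. n \<in> Collect P) U \<or> eventually (\<lambda>n. n \<in> - Collect P) U"
    using assms unfolding nonprincipal_ultrafilter_def by blast
  then show "eventually P U \<or> eventually (\<lambda>n. \<not> P n) U" by simp
qed

lemma ultrafilter_not_eventually: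
  assumes "nonprincipal_ultrafilter U" "\<not> eventually P U"
  shows "eventually (\<lambda>n. \<not> P n) U"
  using nonprincipal_ultrafilterD(2)[OF assms(1)] assms(2) by blast

lemma nonprincipal_ultrafilter_le_sequentially:
  assumes U: "nonprincipal_ultrafilter U" and ev: "eventually P sequentially"
  shows "eventually P U"
proof -
  have "eventually (\<lambda>n. n \<noteq> k) U" for k
  proof (rule ccontr)
    assume "\<not> eventually (\<lambda>n. n \<noteq> k) U"
    then have ev_k: "eventually (\<lambda>n. n = k) U"
      using ultrafilter_not_eventually[OF U] by fastforce
    have "U = principal {k}"
    proof (rule antisym)
      show "U \<le> principal {k}" using ev_k by (simp add: le_principal)
      show "principal {k} \<le> U"
      proof (rule filter_leI)
        fix Q assume "eventually Q U"
        with ev_k have "eventually (\<lambda>n. n = k \<and> Q n) U" by eventually_elim simp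
        then have "\<exists>n. n = k \<and> Q n"
          using eventually_happens nonprincipal_ultrafilterD(1)[OF U] by blast
        then show "eventually Q (principal {k})" by (simp add: eventually_principal)
      qed
    qed
    then show False using U by (simp add: nonprincipal_ultrafilter_def)
  qed
  then have ge: "eventually (\<lambda>n. \<forall>k\<in>{..<N}. n \<noteq> k) U" for N
    by (intro eventually_ball_finite) auto
  obtain N where N: "\<And>n. N \<le> n \<Longrightarrow> P n" using ev by (auto simp: eventually_sequentially)
  show ?thesis using ge[of N] by eventually_elim (metis N lessThan_iff not_le)
qed

text \<open>If no point is a limit, each has a neighbourhood that is avoided almost always; finitely many of
  these cover the space.\<close>

lemma ultrafilter_limit_exists:
  assumes U: "nonprincipal_ultrafilter U" and X: "compact_space X"
    and x: "eventually (\<lambda>n. x n \<in> topspace X) U"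
  shows "\<exists>l. limitin X x l U"
proof (rule ccontr)
  assume "\<not> ?thesis"
  then have "\<forall>l\<in>topspace X. \<exists>N. openin X N \<and> l \<in> N \<and> \<not> eventually (\<lambda>n. x n \<in> N) U"
    by (auto simp: limitin_def)
  then obtain N where N: "\<And>l. l \<in> topspace X \<Longrightarrow> openin X (N l)" "\<And>l. l \<in> topspace X \<Longrightarrow> l \<in> N l"
    "\<And>l. l \<in> topspace X \<Longrightarrow> eventually (\<lambda>n. x n \<notin> N l) U"
    using ultrafilter_not_eventually[OF U] by metis
  have "topspace X \<subseteq> \<Union> (N ` topspace X)" using N(2) by blast
  then obtain F where F: "finite F" "F \<subseteq> N ` topspace X" "topspace X \<subseteq> \<Union> F"
    using X N(1) unfolding compact_space_def compactin_def by (metis imageE)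
  have "eventually (\<lambda>n. \<forall>V\<in>F. x n \<notin> V) U"
    using F N(3) by (intro eventually_ball_finite) auto
  with x have "eventually (\<lambda>n. False) U" by eventually_elim (use F(3) in auto)
  then show False using nonprincipal_ultrafilterD(1)[OF U] by (simp add: trivial_limit_def)
qed

text \<open>All limits along \<open>U\<close> of selections \<open>x n \<in> K n\<close> belong to this set.  The description by neighbourhoods
  makes it closed.\<close>

definition ultralimit :: "nat filter \<Rightarrow> 'b topology \<Rightarrow> (nat \<Rightarrow> 'b set) \<Rightarrow> 'b set" where
  "ultralimit U X K =
     {x \<in> topspace X. \<forall>N. openin X N \<and> x \<in> N \<longrightarrow> eventually (\<lambda>n. K n \<inter> N \<noteq> {}) U}"

lemma compactin_ultralimit:
  assumes "compact_space X" shows "compactin X (ultralimit U X K)"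
proof (rule closedin_compact_space[OF assms])
  have "openin X (topspace X - ultralimit U X K)"
  proof (subst openin_subopen, intro ballI)
    fix x assume x: "x \<in> topspace X - ultralimit U X K"
    then obtain N where N: "openin X N" "x \<in> N" "\<not> eventually (\<lambda>n. K n \<inter> N \<noteq> {}) U"
      by (auto simp: ultralimit_def)
    then have "N \<subseteq> topspace X - ultralimit U X K"
      using openin_subset by (auto simp: ultralimit_def)
    then show "\<exists>T. openin X T \<and> x \<in> T \<and> T \<subseteq> topspace X - ultralimit U X K"
      using N by blast
  qed
  then show "closedin X (ultralimit U X K)"
    by (auto simp: closedin_def ultralimit_def)
qed

text \<open>If the limit set were covered by two disjoint compact pieces, separate them by disjoint open
  sets.  By compactness almost all \<open>K n\<close> lie in their union, hence in one of the two, and the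
  ultrafilter chooses the same one for almost all \<open>n\<close>; the other piece is then empty.\<close>

lemma connectedin_ultralimit:
  assumes U: "nonprincipal_ultrafilter U" and X: "compact_space X" "Hausdorff_space X"
    and K: "eventually (\<lambda>n. connectedin X (K n)) U"
  shows "connectedin X (ultralimit U X K)"
proof -
  let ?A = "ultralimit U X K"
  have False
    if E: "closedin X E1" "closedin X E2" "?A \<subseteq> E1 \<union> E2" "E1 \<inter> E2 \<inter> ?A = {}"
      "E1 \<inter> ?A \<noteq> {}" "E2 \<inter> ?A \<noteq> {}" for E1 E2
  proof -
    have "compactin X (?A \<inter> E1)" "compactin X (?A \<inter> E2)"
      using E compactin_ultralimit[OF X(1)] by (auto intro: compact_Int_closedin)
    moreover have "disjnt (?A \<inter> E1) (?A \<inter> E2)" using E by (auto simp: disjnt_def)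
    ultimately obtain V1 V2 where V: "openin X V1" "openin X V2" "?A \<inter> E1 \<subseteq> V1" "?A \<inter> E2 \<subseteq> V2"
      "disjnt V1 V2"
      using Hausdorff_space_compact_separation[OF X(2)] by metis
    have cover: "eventually (\<lambda>n. K n \<subseteq> V1 \<union> V2) U"
    proof (rule ccontr)
      assume "\<not> eventually (\<lambda>n. K n \<subseteq> V1 \<union> V2) U"
      then have ex: "eventually (\<lambda>n. \<exists>x. x \<in> K n - (V1 \<union> V2)) U"
        using ultrafilter_not_eventually[OF U] by (fastforce elim: eventually_mono)
      define x where "x n = (SOME x. x \<in> K n - (V1 \<union> V2))" for n
      have x: "eventually (\<lambda>n. x n \<in> K n - (V1 \<union> V2)) U"
        using ex unfolding x_def by eventually_elim (rule someI_ex)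
      have "eventually (\<lambda>n. x n \<in> topspace X) U"
        using x K by eventually_elim (use connectedin_subset_topspace in blast)
      then obtain l where l: "limitin X x l U"
        using ultrafilter_limit_exists[OF U X(1)] by blast
      have "l \<in> ?A"
        unfolding ultralimit_def
      proof (intro CollectI conjI allI impI)
        show "l \<in> topspace X" using l by (simp add: limitin_def)
        fix N assume "openin X N \<and> l \<in> N"
        then have "eventually (\<lambda>n. x n \<in> N) U" using l by (simp add: limitin_def)
        with x show "eventually (\<lambda>n. K n \<inter> N \<noteq> {}) U" by eventually_elim blast
      qed
      then have "l \<in> V1 \<union> V2" using E V by blast
      moreover have "openin X (V1 \<union> V2)" using V by blast
      ultimately have "eventually (\<lambda>n. x n \<in> V1 \<union> V2) U" using l unfolding limitin_def by blast
      with x have "eventually (\<lambda>n. False) U" by eventually_elim blast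
      then show False using nonprincipal_ultrafilterD(1)[OF U] by (simp add: trivial_limit_def)
    qed
    have meets: "eventually (\<lambda>n. K n \<inter> V1 \<noteq> {}) U" "eventually (\<lambda>n. K n \<inter> V2 \<noteq> {}) U"
    proof -
      obtain x1 x2 where x: "x1 \<in> ?A" "x1 \<in> V1" "x2 \<in> ?A" "x2 \<in> V2"
        using E(5,6) V(3,4) by blast
      show "eventually (\<lambda>n. K n \<inter> V1 \<noteq> {}) U" "eventually (\<lambda>n. K n \<inter> V2 \<noteq> {}) U"
        using x V(1,2) by (simp_all add: ultralimit_def)
    qed
    from cover K meets have "eventually (\<lambda>n. False) U"
    proof eventually_elim
      case (elim n)
      from elim(2) have "\<not> (openin X V1 \<and> openin X V2 \<and> K n \<subseteq> V1 \<union> V2 \<and> V1 \<inter> V2 \<inter> K n = {} \<and>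
          V1 \<inter> K n \<noteq> {} \<and> V2 \<inter> K n \<noteq> {})"
        by (auto simp: connectedin)
      moreover have "V1 \<inter> V2 \<inter> K n = {}" using V(5) by (auto simp: disjnt_def)
      moreover have "V1 \<inter> K n \<noteq> {}" "V2 \<inter> K n \<noteq> {}" using elim(3,4) by (simp_all add: Int_commute)
      ultimately show ?case using V(1,2) elim(1) by simp
    qed
    then show False using nonprincipal_ultrafilterD(1)[OF U] by (simp add: trivial_limit_def)
  qed
  moreover have "?A \<subseteq> topspace X" by (auto simp: ultralimit_def)
  ultimately show ?thesis unfolding connectedin_closedin by blast
qed


section \<open>Algebraically closed nonarchimedean fields\<close>

locale alg_closed_nonarch_field = complete_nonarch_field av
  for av :: "'a::alg_closed_field \<Rightarrow> real"
begin

lemma av_0 [simp]: "av 0 = 0"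
  by (simp add: av_eq_0_iff)

lemma av_1 [simp]: "av 1 = 1"
  using av_mult[of 1 1] av_eq_0_iff[of 1] by simp

lemma av_minus [simp]: "av (- x) = av x"
proof -
  have "av (- x) ^ 2 = av x ^ 2"
    using av_mult[of "-x" "-x"] av_mult[of x x] by (simp add: power2_eq_square)
  thus ?thesis using av_nonneg by (simp add: power2_eq_iff_nonneg)
qed

lemma av_minus_commute: "av (x - y) = av (y - x)"
  using av_minus[of "x - y"] by simp

lemma av_diff_le: "av (x - y) \<le> max (av x) (av y)"
  using av_ultrametric[of x "- y"] by simp

lemma av_pos: "x \<noteq> 0 \<Longrightarrow> 0 < av x"
  using av_nonneg[of x] av_eq_0_iff[of x] by linarith

lemma av_power: "av (x ^ n) = av x ^ n"
  by (induction n) (auto simp: av_mult)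

lemma av_inverse: "av (inverse x) = inverse (av x)"
proof (cases "x = 0")
  case False
  then have "av x * av (inverse x) = 1"
    using av_mult[of x "inverse x"] by simp
  then show ?thesis by (simp add: inverse_unique)
qed simp

lemma av_divide: "av (x / y) = av x / av y"
  by (simp add: divide_inverse av_mult av_inverse)

lemma av_add_eq_max:
  assumes "av x < av y" shows "av (x + y) = av y"
proof -
  have "av y \<le> max (av (x + y)) (av x)"
    using av_diff_le[of "x + y" x] by simp
  then show ?thesis using av_ultrametric[of x y] assms by linarith
qed

lemma av_diff_eq_max:
  assumes "av x \<noteq> av y" shows "av (x - y) = max (av x) (av y)"
proof (cases "av x < av y")
  case True
  then show ?thesis using av_add_eq_max[of x "-y"] by simp
next
  case False
  then have "av y < av x" using assms by simp
  then show ?thesis using av_add_eq_max[of "-y" x] by simp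
qed

lemma av_sum_le:
  assumes "\<And>i. i \<in> I \<Longrightarrow> av (f i) \<le> C" "0 \<le> C"
  shows "av (sum f I) \<le> C"
  using assms
proof (induction I rule: infinite_finite_induct)
  case (insert i I)
  then show ?case
    using av_ultrametric[of "f i" "sum f I"] by (force simp: max_def split: if_splits)
qed auto

lemma ex_small_av:
  assumes "0 < e" shows "\<exists>c. c \<noteq> 0 \<and> av c < e"
proof -
  obtain x where x: "x \<noteq> 0" "av x \<noteq> 1" using av_nontrivial by blast
  have "\<exists>y. y \<noteq> 0 \<and> av y < 1"
  proof (cases "av x < 1")
    case False
    then have "av (inverse x) < 1" using x by (simp add: av_inverse inverse_less_1_iff av_pos)
    then show ?thesis using x by (intro exI[of _ "inverse x"]) auto
  qed (use x in blast)
  then obtain y where y: "y \<noteq> 0" "av y < 1" by blast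
  obtain n where "av y ^ n < e"
    using real_arch_pow_inv[OF assms y(2)] by blast
  then show ?thesis using y by (intro exI[of _ "y ^ n"]) (auto simp: av_power)
qed

text \<open>A root \<open>x\<close> of \<open>\<Prod>(X - c) - 1\<close> is integral, so each factor \<open>x - c\<close> has absolute value at
  most \<open>1\<close> while their product is \<open>1\<close>.  This expresses that the residue field is infinite.\<close>

lemma ex_av_diff_eq_1:
  assumes "finite S" "\<And>c. c \<in> S \<Longrightarrow> av c \<le> 1"
  shows "\<exists>x. \<forall>c\<in>S. av (x - c) = 1"
proof (cases "S = {}")
  case False
  define p where "p = (\<Prod>c\<in>S. [:-c, 1:]) - 1"
  have "degree (\<Prod>c\<in>S. [:-c, 1:]) = card S"
    by (subst degree_prod_eq_sum_degree) auto
  moreover have "card S > 0" using False assms by (simp add: card_gt_0_iff)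
  ultimately have "degree p > 0"
    unfolding p_def by (metis degree_1 degree_add_eq_right degree_minus uminus_add_conv_diff)
  then obtain x where "poly p x = 0" using alg_closed_imp_poly_has_root by blast
  then have prod: "(\<Prod>c\<in>S. x - c) = 1"
    by (simp add: p_def poly_prod)
  have avp: "(\<Prod>c\<in>S. av (x - c)) = 1"
  proof -
    have "av (\<Prod>c\<in>S. x - c) = (\<Prod>c\<in>S. av (x - c))"
      using assms(1) by (induction rule: finite_induct) (auto simp: av_mult)
    then show ?thesis using prod by simp
  qed
  have x1: "av x \<le> 1"
  proof (rule ccontr)
    assume "\<not> av x \<le> 1"
    then have "av (x - c) > 1" if "c \<in> S" for c
      using assms(2)[OF that] by (subst av_diff_eq_max) auto
    moreover obtain c0 where "c0 \<in> S" using False by blast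
    ultimately have "(\<Prod>c\<in>S. 1::real) < (\<Prod>c\<in>S. av (x - c))"
      using assms(1) by (intro prod_mono_strict[of c0]) (auto intro: less_imp_le less_trans[of 0 1])
    then show False using avp by simp
  qed
  have le1: "av (x - c) \<le> 1" if "c \<in> S" for c
    using av_diff_le[of x c] x1 assms(2)[OF that] by linarith
  have "av (x - c) = 1" if "c \<in> S" for c
  proof -
    have "1 = av (x - c) * (\<Prod>c\<in>S-{c}. av (x - c))"
      using avp prod.remove[OF assms(1) that, of "\<lambda>c. av (x - c)"] by simp
    also have "\<dots> \<le> av (x - c) * 1"
      by (intro mult_left_mono prod_le_1) (auto simp: av_nonneg le1)
    finally show ?thesis using le1[OF that] by simp
  qed
  then show ?thesis by blast
qed auto


section \<open>Norms of polynomials on discs\<close>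

definition gauss :: "real \<Rightarrow> 'a poly \<Rightarrow> real" where
  "gauss r p = Max ((\<lambda>k. av (coeff p k) * r ^ k) ` {..degree p})"

lemma gauss_ge:
  assumes "0 \<le> r" shows "av (coeff p k) * r ^ k \<le> gauss r p"
proof (cases "k \<le> degree p")
  case True
  then show ?thesis unfolding gauss_def by (intro Max_ge) auto
next
  case False
  then have "av (coeff p k) * r ^ k = 0" by (simp add: coeff_eq_0)
  also have "0 \<le> av (coeff p 0) * r ^ 0" by (simp add: av_nonneg)
  also have "\<dots> \<le> gauss r p" unfolding gauss_def by (rule Max_ge) (auto simp del: power_0)
  finally show ?thesis .
qed

lemma gauss_leI: "(\<And>k. av (coeff p k) * r ^ k \<le> C) \<Longrightarrow> gauss r p \<le> C"
  unfolding gauss_def by (subst Max_le_iff) auto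

lemma gauss_attained: "\<exists>k. gauss r p = av (coeff p k) * r ^ k"
proof -
  have "gauss r p \<in> (\<lambda>k. av (coeff p k) * r ^ k) ` {..degree p}"
    unfolding gauss_def by (intro Max_in) auto
  then show ?thesis by blast
qed

lemma gauss_nonneg: "0 \<le> r \<Longrightarrow> 0 \<le> gauss r p"
  by (rule order_trans[OF _ gauss_ge[of r p 0]]) (simp_all add: av_nonneg)

lemma gauss_add_le:
  assumes "0 \<le> r" shows "gauss r (p + q) \<le> max (gauss r p) (gauss r q)"
proof (rule gauss_leI)
  fix k
  have "av (coeff (p + q) k) * r ^ k \<le> max (av (coeff p k)) (av (coeff q k)) * r ^ k"
    using assms by (intro mult_right_mono) (auto simp: av_ultrametric)
  also have "\<dots> \<le> max (gauss r p) (gauss r q)"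
    using gauss_ge[OF assms, of p k] gauss_ge[OF assms, of q k] by (auto simp: max_def)
  finally show "av (coeff (p + q) k) * r ^ k \<le> max (gauss r p) (gauss r q)" .
qed

lemma gauss_const [simp]: "gauss r [:c:] = av c"
  by (simp add: gauss_def)

lemma gauss_linear: "0 \<le> r \<Longrightarrow> gauss r [:c, 1:] = max (av c) r"
  by (simp add: gauss_def atMost_Suc max.commute)

lemma gauss_minus: "gauss r (- p) = gauss r p"
  by (simp add: gauss_def)

lemma gauss_mult_le:
  assumes "0 \<le> r" shows "gauss r (p * q) \<le> gauss r p * gauss r q"
proof (rule gauss_leI)
  fix k
  have *: "av (coeff p i * coeff q (k - i)) * r ^ k \<le> gauss r p * gauss r q" if "i \<le> k" for i
  proof -
    have "av (coeff p i * coeff q (k - i)) * r ^ k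
        = (av (coeff p i) * r ^ i) * (av (coeff q (k - i)) * r ^ (k - i))"
      using that by (simp add: av_mult power_add[symmetric] mult_ac)
    also have "\<dots> \<le> gauss r p * gauss r q"
      using assms by (intro mult_mono gauss_ge gauss_nonneg) (auto simp: av_nonneg)
    finally show ?thesis .
  qed
  show "av (coeff (p * q) k) * r ^ k \<le> gauss r p * gauss r q"
  proof (cases "r ^ k = 0")
    case True
    have "0 \<le> gauss r p * gauss r q"
      by (intro mult_nonneg_nonneg gauss_nonneg assms)
    then show ?thesis by (simp only: True mult_zero_right)
  next
    case False
    then have pos: "r ^ k > 0" using zero_le_power[OF assms, of k] by linarith
    have "av (coeff (p * q) k) \<le> gauss r p * gauss r q / r ^ k"
      unfolding coeff_mult
      by (rule av_sum_le)
        (use pos * gauss_nonneg[OF assms] in \<open>auto simp: field_simps\<close>)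
    then show ?thesis using pos by (simp add: field_simps)
  qed
qed

text \<open>Gauss's lemma: at the sum of the two first indices where the terms of \<open>p\<close> and \<open>q\<close> are
  maximal, exactly one product in the convolution attains the maximum.\<close>

lemma gauss_mult_pos:
  assumes r: "0 < r" shows "gauss r (p * q) = gauss r p * gauss r q"
proof (cases "gauss r p = 0 \<or> gauss r q = 0")
  case True
  then have "gauss r (p * q) \<le> 0" using gauss_mult_le[of r p q] r by auto
  then show ?thesis using True gauss_nonneg[of r "p * q"] r by auto
next
  case False
  define i where "i = (LEAST k. gauss r p = av (coeff p k) * r ^ k)"
  define j where "j = (LEAST k. gauss r q = av (coeff q k) * r ^ k)"
  have i: "gauss r p = av (coeff p i) * r ^ i"
    unfolding i_def by (rule LeastI_ex[OF gauss_attained])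
  have j: "gauss r q = av (coeff q j) * r ^ j"
    unfolding j_def by (rule LeastI_ex[OF gauss_attained])
  have il: "av (coeff p k) * r ^ k < gauss r p" if "k < i" for k
    using gauss_ge[of r p k] r not_less_Least[of k "\<lambda>k. gauss r p = av (coeff p k) * r ^ k"] that
    unfolding i_def by fastforce
  have jl: "av (coeff q k) * r ^ k < gauss r q" if "k < j" for k
    using gauss_ge[of r q k] r not_less_Least[of k "\<lambda>k. gauss r q = av (coeff q k) * r ^ k"] that
    unfolding j_def by fastforce
  have pos: "0 < gauss r p" "0 < gauss r q"
    using False gauss_nonneg[of r p] gauss_nonneg[of r q] r by linarith+
  define t where "t k = coeff p k * coeff q (i + j - k)" for k
  have eq: "av (t k) * r ^ (i + j) = (av (coeff p k) * r ^ k) * (av (coeff q (i + j - k)) * r ^ (i + j - k))"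
    if "k \<le> i + j" for k
    using that by (simp add: t_def av_mult power_add[symmetric] mult_ac)
  have main: "av (t i) * r ^ (i + j) = gauss r p * gauss r q"
    using eq[of i] i j by simp
  have small: "av (t k) < av (t i)" if "k \<le> i + j" "k \<noteq> i" for k
  proof -
    have "av (t k) * r ^ (i + j) < gauss r p * gauss r q"
    proof (cases "k < i")
      case True
      then show ?thesis unfolding eq[OF that(1)]
        using il[of k] gauss_ge[of r q "i + j - k"] pos r
        by (intro mult_less_le_imp_less_nonneg) (auto simp: av_nonneg)
    next
      case False
      then have "i + j - k < j" using that by simp
      then show ?thesis unfolding eq[OF that(1)]
        using jl[of "i + j - k"] gauss_ge[of r p k] pos r
        by (subst (1 2) mult.commute, intro mult_less_le_imp_less_nonneg) (auto simp: av_nonneg)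
    qed
    then show ?thesis unfolding main[symmetric] using r by simp
  qed
  have "coeff (p * q) (i + j) = t i + (\<Sum>k\<in>{..i+j}-{i}. t k)"
    unfolding coeff_mult t_def by (subst sum.remove[of _ i]) auto
  moreover have "av (\<Sum>k\<in>{..i+j}-{i}. t k) < av (t i)"
  proof -
    have fin: "finite ({..i+j}-{i})" by simp
    have "av (t i) > 0" using main pos r
      by (metis mult_pos_pos zero_less_mult_pos2 zero_less_power)
    define C where "C = Max (insert 0 ((\<lambda>k. av (t k)) ` ({..i+j}-{i})))"
    have "av (\<Sum>k\<in>{..i+j}-{i}. t k) \<le> C"
      unfolding C_def by (rule av_sum_le) auto
    also have "C < av (t i)"
      unfolding C_def using small \<open>av (t i) > 0\<close> by (subst Max_less_iff) auto
    finally show ?thesis .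
  qed
  ultimately have "av (coeff (p * q) (i + j)) = av (t i)"
    using av_add_eq_max by (metis add.commute)
  then have "gauss r p * gauss r q \<le> gauss r (p * q)"
    using main gauss_ge[of r "p * q" "i + j"] r by simp
  then show ?thesis using gauss_mult_le[of r p q] r by simp
qed

lemma gauss_0_radius: "gauss 0 p = av (poly p 0)"
proof (rule antisym)
  show "gauss 0 p \<le> av (poly p 0)"
    by (rule gauss_leI) (auto simp: poly_0_coeff_0 av_nonneg power_0_left)
  show "av (poly p 0) \<le> gauss 0 p"
    using gauss_ge[of 0 p 0] by (simp add: poly_0_coeff_0)
qed

lemma gauss_mult: "0 \<le> r \<Longrightarrow> gauss r (p * q) = gauss r p * gauss r q"
  by (cases "r = 0") (auto simp: gauss_0_radius gauss_mult_pos av_mult)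

text \<open>The Gauss norm of radius \<open>r\<close> about \<open>a\<close>: it is the supremum norm on the closed disc of
  radius \<open>r\<close> about \<open>a\<close>, since the value group is dense and the residue field infinite.\<close>

definition disc_norm :: "'a \<Rightarrow> real \<Rightarrow> 'a poly \<Rightarrow> real" where
  "disc_norm a r p = gauss r (pcompose p [:a, 1:])"

lemma disc_norm_nonneg: "0 \<le> r \<Longrightarrow> 0 \<le> disc_norm a r p"
  by (simp add: disc_norm_def gauss_nonneg)

lemma disc_norm_mult: "0 \<le> r \<Longrightarrow> disc_norm a r (p * q) = disc_norm a r p * disc_norm a r q"
  by (simp add: disc_norm_def gauss_mult pcompose_mult)

lemma disc_norm_const [simp]: "disc_norm a r [:c:] = av c"
  by (simp add: disc_norm_def)

lemma disc_norm_0 [simp]: "disc_norm a r 0 = 0"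
  using disc_norm_const[of a r 0] by simp

lemma disc_norm_1 [simp]: "disc_norm a r 1 = 1"
  using disc_norm_const[of a r 1] by (simp add: one_pCons)

lemma disc_norm_smult: "0 \<le> r \<Longrightarrow> disc_norm a r (smult c p) = av c * disc_norm a r p"
  using disc_norm_mult[of r a "[:c:]" p] by simp

lemma disc_norm_minus: "disc_norm a r (- p) = disc_norm a r p"
  by (simp add: disc_norm_def gauss_minus pcompose_uminus)

lemma disc_norm_power: "0 \<le> r \<Longrightarrow> disc_norm a r (p ^ n) = disc_norm a r p ^ n"
  by (induction n) (auto simp: disc_norm_mult)

lemma disc_norm_prod: "0 \<le> r \<Longrightarrow> disc_norm a r (prod f I) = (\<Prod>i\<in>I. disc_norm a r (f i))"
  by (induction I rule: infinite_finite_induct) (auto simp: disc_norm_mult)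

lemma disc_norm_prod_mset:
  "0 \<le> r \<Longrightarrow> disc_norm a r (\<Prod>w\<in>#W. f w) = (\<Prod>w\<in>#W. disc_norm a r (f w))"
  by (induction W) (auto simp: disc_norm_mult)

lemma disc_norm_add_le:
  "0 \<le> r \<Longrightarrow> disc_norm a r (p + q) \<le> max (disc_norm a r p) (disc_norm a r q)"
  by (simp add: disc_norm_def gauss_add_le pcompose_add)

lemma disc_norm_diff_le:
  "0 \<le> r \<Longrightarrow> disc_norm a r (p - q) \<le> max (disc_norm a r p) (disc_norm a r q)"
  using disc_norm_add_le[of r a p "- q"] by (simp add: disc_norm_minus)

lemma disc_norm_linear: "0 \<le> r \<Longrightarrow> disc_norm a r [:- w, 1:] = max (av (a - w)) r"
  by (simp add: disc_norm_def pcompose_pCons gauss_linear)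

lemma disc_norm_0_radius: "disc_norm a 0 p = av (poly p a)"
  by (simp add: disc_norm_def gauss_0_radius poly_pcompose)

lemma disc_norm_0_centre: "disc_norm 0 r p = gauss r p"
  by (simp add: disc_norm_def)

lemma disc_norm_root_product:
  assumes "0 \<le> r"
  shows "disc_norm a r (smult c (\<Prod>w\<in>#W. [:- w, 1:])) = av c * (\<Prod>w\<in>#W. max (av (a - w)) r)"
  using assms by (simp add: disc_norm_smult disc_norm_prod_mset disc_norm_linear)

text \<open>For a linear factor this is the ultrametric inequality; the general case follows because
  the norms are multiplicative and polynomials split.\<close>

lemma disc_norm_mono:
  assumes "0 \<le> r" "r \<le> s" "av (a - b) \<le> s"
  shows "disc_norm a r p \<le> disc_norm b s p"
proof (cases "p = 0")
  case False
  obtain W where W: "p = smult (lead_coeff p) (\<Prod>x\<in>#W. [:-x, 1:])"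
    using alg_closed_imp_factorization[OF False] by blast
  have "max (av (a - w)) r \<le> max (av (b - w)) s" for w
  proof -
    have "a - w = (a - b) + (b - w)" by simp
    then have "av (a - w) \<le> max (av (a - b)) (av (b - w))" by (metis av_ultrametric)
    then show ?thesis using assms by linarith
  qed
  then have le: "(\<Prod>w\<in>#W. max (av (a - w)) r) \<le> (\<Prod>w\<in>#W. max (av (b - w)) s)"
    using assms by (intro prod_mset_mono_real) (auto simp: le_max_iff_disj)
  define c where "c = lead_coeff p"
  have "disc_norm a r p = av c * (\<Prod>w\<in>#W. max (av (a - w)) r)"
    using W assms disc_norm_root_product[of r a c W] unfolding c_def[symmetric] by simp
  moreover have "disc_norm b s p = av c * (\<Prod>w\<in>#W. max (av (b - w)) s)"
    using W assms disc_norm_root_product[of s b c W] unfolding c_def[symmetric] by simp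
  ultimately show ?thesis using le by (simp add: mult_left_mono av_nonneg)
qed simp

lemma disc_norm_recentre:
  assumes "0 \<le> r" "av (a - b) \<le> r" shows "disc_norm a r p = disc_norm b r p"
  using assms disc_norm_mono[of r r a b p] disc_norm_mono[of r r b a p]
  by (simp add: av_minus_commute)

lemma poly_le_disc_norm: "0 \<le> r \<Longrightarrow> av (poly p a) \<le> disc_norm a r p"
  using disc_norm_mono[of 0 r a a p] by (simp add: disc_norm_0_radius)

lemma disc_norm_le_gauss:
  assumes "0 \<le> r" "r \<le> s" "av a \<le> s"
  shows "disc_norm a r p \<le> gauss s p"
  using disc_norm_mono[of r s a 0 p] assms by (simp add: disc_norm_0_centre)

lemma disc_norm_diff_abs:
  assumes "0 \<le> r"
  shows "\<bar>disc_norm a r p - disc_norm a r q\<bar> \<le> disc_norm a r (p - q)"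
  using disc_norm_add_le[OF assms, of a "p - q" q] disc_norm_diff_le[OF assms, of a p "p - q"]
    disc_norm_nonneg[OF assms, of a]
  by (smt (verit, ccfv_SIG) add.commute diff_add_cancel diff_diff_eq2 add_diff_cancel_left')

text \<open>Two polynomials that agree below degree \<open>e\<close> and have coefficients of size at most \<open>C\<close> are
  close on every disc contained in a fixed disc about \<open>0\<close> of radius less than \<open>1\<close>.\<close>

lemma disc_norm_diff_close:
  assumes "0 \<le> r" "r \<le> s" "av a \<le> s" "s \<le> 1"
    and "\<And>k. k < e \<Longrightarrow> coeff p k = coeff q k"
    and "\<And>k. av (coeff p k) \<le> C" "\<And>k. av (coeff q k) \<le> C"
  shows "disc_norm a r (p - q) \<le> C * s ^ e"
proof -
  have s: "0 \<le> s" using assms by simp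
  have C: "0 \<le> C" using assms(6)[of 0] av_nonneg order_trans by blast
  have "disc_norm a r (p - q) \<le> gauss s (p - q)"
    using assms by (intro disc_norm_le_gauss)
  also have "\<dots> \<le> C * s ^ e"
  proof (rule gauss_leI)
    fix k
    show "av (coeff (p - q) k) * s ^ k \<le> C * s ^ e"
    proof (cases "k < e")
      case False
      have "av (coeff (p - q) k) \<le> C"
        using av_diff_le[of "coeff p k" "coeff q k"] assms(6)[of k] assms(7)[of k] by simp
      moreover have "s ^ k \<le> s ^ e" using False s assms by (intro power_decreasing) auto
      ultimately show ?thesis using s C av_nonneg by (intro mult_mono) auto
    qed (use assms s C in auto)
  qed
  finally show ?thesis .
qed

lemma disc_norm_close:
  assumes "0 \<le> r" "r \<le> s" "av a \<le> s" "s \<le> 1"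
    and "\<And>k. k < e \<Longrightarrow> coeff p k = coeff q k"
    and "\<And>k. av (coeff p k) \<le> C" "\<And>k. av (coeff q k) \<le> C"
  shows "\<bar>disc_norm a r p - disc_norm a r q\<bar> \<le> C * s ^ e"
  by (rule order_trans[OF disc_norm_diff_abs disc_norm_diff_close]) (use assms in auto)

lemma gauss_1_coeff_le: "av (coeff p k) \<le> gauss 1 p"
  using gauss_ge[of 1 p k] by simp

text \<open>Since \<open>s ^ k - r ^ k \<le> (s - r) * (\<Sum>i<k. t ^ i)\<close> for \<open>r \<le> s \<le> t\<close>, all terms of the expansion
  around the centre have a common Lipschitz constant in the radius.\<close>

lemma disc_norm_Lipschitz:
  assumes "0 \<le> r" "r \<le> s" "s \<le> t" "t < 1" "av a \<le> 1"
  shows "disc_norm a s p \<le> disc_norm a r p + gauss 1 p / (1 - t) * (s - r)"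
proof -
  define q where "q = pcompose p [:a, 1:]"
  have C: "gauss 1 q = gauss 1 p"
    using disc_norm_recentre[of 1 a 0 p] assms by (simp add: q_def disc_norm_def)
  have "gauss s q \<le> gauss r q + gauss 1 p / (1 - t) * (s - r)"
  proof (rule gauss_leI)
    fix k
    have pow: "s ^ k - r ^ k \<le> (s - r) * (1 / (1 - t))"
    proof -
      have "s ^ k - r ^ k = (s - r) * (\<Sum>i<k. r ^ (k - Suc i) * s ^ i)"
        by (rule power_diff_sumr2)
      also have "\<dots> \<le> (s - r) * (\<Sum>i<k. t ^ i)"
      proof (intro mult_left_mono sum_mono)
        fix i
        have "r ^ (k - Suc i) * s ^ i \<le> 1 * t ^ i"
          using assms by (intro mult_mono power_mono power_le_one) auto
        then show "r ^ (k - Suc i) * s ^ i \<le> t ^ i" by simp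
      qed (use assms in auto)
      also have "(\<Sum>i<k. t ^ i) \<le> 1 / (1 - t)"
      proof -
        have "(\<Sum>i<k. t ^ i) \<le> (\<Sum>i. t ^ i)"
          using assms by (intro sum_le_suminf summable_geometric) auto
        then show ?thesis using assms by (simp add: suminf_geometric)
      qed
      finally show ?thesis using assms by (simp add: mult_left_mono)
    qed
    have "av (coeff q k) * s ^ k = av (coeff q k) * r ^ k + av (coeff q k) * (s ^ k - r ^ k)"
      by (simp add: algebra_simps)
    also have "av (coeff q k) * (s ^ k - r ^ k) \<le> gauss 1 p * ((s - r) * (1 / (1 - t)))"
      using pow gauss_1_coeff_le[of q k] C av_nonneg assms gauss_nonneg[of 1 p]
      by (intro mult_mono) (auto intro!: power_mono)
    also have "av (coeff q k) * r ^ k \<le> gauss r q"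
      using assms by (intro gauss_ge) auto
    finally show "av (coeff q k) * s ^ k \<le> gauss r q + gauss 1 p / (1 - t) * (s - r)"
      by (simp add: mult_ac)
  qed
  then show ?thesis by (simp add: disc_norm_def q_def)
qed

lemma disc_norm_sum_le:
  assumes r: "0 \<le> r" and f: "\<And>i. i \<in> I \<Longrightarrow> disc_norm a r (f i) \<le> C" and C: "0 \<le> C"
  shows "disc_norm a r (\<Sum>i\<in>I. f i) \<le> C"
  using f
proof (induction I rule: infinite_finite_induct)
  case (insert i I)
  then have "disc_norm a r (f i) \<le> C" "disc_norm a r (\<Sum>i\<in>I. f i) \<le> C" by auto
  then show ?case
    using disc_norm_add_le[OF r, of a "f i" "\<Sum>i\<in>I. f i"] insert.hyps by simp
qed (use C in auto)


section \<open>Norms of bounded power series on discs\<close>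

lemma HinfI: "(\<And>k. av (fps_nth f k) \<le> C) \<Longrightarrow> f \<in> Hinf av"
  unfolding Hinf_def by (auto intro!: bdd_aboveI[of _ C])

lemma coeff_le_Hinf_norm: "f \<in> Hinf av \<Longrightarrow> av (fps_nth f k) \<le> Hinf_norm av f"
  unfolding Hinf_norm_def Hinf_def by (auto intro: cSUP_upper)

lemma Hinf_norm_leI:
  "f \<in> Hinf av \<Longrightarrow> (\<And>k. av (fps_nth f k) \<le> C) \<Longrightarrow> Hinf_norm av f \<le> C"
  unfolding Hinf_norm_def by (auto intro: cSUP_least)

lemma Hinf_norm_nonneg: "f \<in> Hinf av \<Longrightarrow> 0 \<le> Hinf_norm av f"
  using coeff_le_Hinf_norm[of f 0] av_nonneg order_trans by blast

definition trunc :: "nat \<Rightarrow> 'a fps \<Rightarrow> 'a poly" where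
  "trunc N f = (\<Sum>k<N. monom (fps_nth f k) k)"

lemma coeff_trunc: "coeff (trunc N f) k = (if k < N then fps_nth f k else 0)"
  by (simp add: trunc_def coeff_sum)

lemma av_coeff_trunc_le: "f \<in> Hinf av \<Longrightarrow> av (coeff (trunc N f) k) \<le> Hinf_norm av f"
  by (simp add: coeff_trunc coeff_le_Hinf_norm Hinf_norm_nonneg)

lemma gauss_1_trunc_le: "f \<in> Hinf av \<Longrightarrow> gauss 1 (trunc N f) \<le> Hinf_norm av f"
  by (rule gauss_leI) (simp add: av_coeff_trunc_le)

text \<open>On the disc of radius \<open>r < 1\<close> about \<open>a\<close>, the Gauss norm of a bounded series is the limit of
  the norms of its truncations.  In this way the series need never be expanded around \<open>a\<close>.\<close>

definition zeta :: "'a \<Rightarrow> real \<Rightarrow> 'a fps \<Rightarrow> real" where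
  "zeta a r = (\<lambda>f\<in>Hinf av. lim (\<lambda>N. disc_norm a r (trunc N f)))"

lemma zeta_trunc_tendsto:
  assumes "f \<in> Hinf av" "0 \<le> r" "r < 1" "av a < 1"
  shows "(\<lambda>N. disc_norm a r (trunc N f)) \<longlonglongrightarrow> zeta a r f"
proof -
  define s where "s = max r (av a)"
  define C where "C = Hinf_norm av f"
  have C: "0 \<le> C" using assms by (simp add: C_def Hinf_norm_nonneg)
  have s: "r \<le> s" "av a \<le> s" "0 \<le> s" "s < 1" using assms by (auto simp: s_def)
  have close: "\<bar>disc_norm a r (trunc m f) - disc_norm a r (trunc n f)\<bar> \<le> C * s ^ e"
    if "e \<le> m" "e \<le> n" for e m n
    using that assms s
    by (intro disc_norm_close) (auto simp: C_def coeff_trunc coeff_le_Hinf_norm Hinf_norm_nonneg)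
  have lim0: "(\<lambda>e. C * s ^ e) \<longlonglongrightarrow> 0"
    using s by (auto intro!: tendsto_mult_right_zero LIMSEQ_realpow_zero)
  have "Cauchy (\<lambda>N. disc_norm a r (trunc N f))"
  proof (rule CauchyI)
    fix e :: real assume "0 < e"
    then have "eventually (\<lambda>M. C * s ^ M < e) sequentially"
      using order_tendstoD(2)[OF lim0] by blast
    then obtain M where "C * s ^ M < e" by (auto simp: eventually_sequentially)
    then show "\<exists>M. \<forall>m\<ge>M. \<forall>n\<ge>M. norm (disc_norm a r (trunc m f) - disc_norm a r (trunc n f)) < e"
      using close by (intro exI[of _ M]) (auto intro: order_le_less_trans)
  qed
  then have "convergent (\<lambda>N. disc_norm a r (trunc N f))"
    by (rule Cauchy_convergent)
  then show ?thesis using assms by (simp add: zeta_def convergent_LIMSEQ_iff)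
qed

lemma zeta_trunc_close:
  assumes "f \<in> Hinf av" "0 \<le> r" "r \<le> s" "s < 1" "av a \<le> s"
  shows "\<bar>disc_norm a r (trunc N f) - zeta a r f\<bar> \<le> Hinf_norm av f * s ^ N"
proof (rule LIMSEQ_le_const2)
  show "(\<lambda>M. \<bar>disc_norm a r (trunc N f) - disc_norm a r (trunc M f)\<bar>)
      \<longlonglongrightarrow> \<bar>disc_norm a r (trunc N f) - zeta a r f\<bar>"
    using assms by (intro tendsto_intros zeta_trunc_tendsto) auto
  show "\<exists>K. \<forall>M\<ge>K. \<bar>disc_norm a r (trunc N f) - disc_norm a r (trunc M f)\<bar> \<le> Hinf_norm av f * s ^ N"
    using assms
    by (intro exI[of _ N] allI impI disc_norm_close)
      (auto simp: coeff_trunc coeff_le_Hinf_norm Hinf_norm_nonneg)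
qed

text \<open>Sums, products and infinite products are all computed through this lemma: any coefficientwise
  eventually constant and uniformly bounded sequence of polynomials may replace the truncations.\<close>

lemma zeta_tendsto:
  assumes coeff: "\<And>k. eventually (\<lambda>N. coeff (p N) k = fps_nth f k) sequentially"
    and bound: "\<And>N k. av (coeff (p N) k) \<le> C"
  shows Hinf_if_approx: "f \<in> Hinf av"
    and "\<lbrakk>0 \<le> r; r < 1; av a < 1\<rbrakk> \<Longrightarrow> (\<lambda>N. disc_norm a r (p N)) \<longlonglongrightarrow> zeta a r f"
proof -
  have fC: "av (fps_nth f k) \<le> C" for k
  proof -
    obtain N where "coeff (p N) k = fps_nth f k"
      using eventually_happens[OF coeff[of k]] by auto
    then show ?thesis using bound[of N k] by simp
  qed
  show f: "f \<in> Hinf av" using fC by (rule HinfI)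
  assume asm: "0 \<le> r" "r < 1" "av a < 1"
  have C: "0 \<le> C" using fC[of 0] av_nonneg order_trans by blast
  define s where "s = max r (av a)"
  have s: "r \<le> s" "av a \<le> s" "0 \<le> s" "s < 1" using asm by (auto simp: s_def)
  have lim0: "(\<lambda>e. C * s ^ e) \<longlonglongrightarrow> 0"
    using s by (auto intro!: tendsto_mult_right_zero LIMSEQ_realpow_zero)
  have "(\<lambda>N. disc_norm a r (p N) - disc_norm a r (trunc N f)) \<longlonglongrightarrow> 0"
  proof (rule tendstoI)
    fix e :: real assume "0 < e"
    then have "eventually (\<lambda>M. C * s ^ M < e) sequentially"
      using order_tendstoD(2)[OF lim0] by blast
    then obtain M where M: "C * s ^ M < e" by (auto simp: eventually_sequentially)
    have "eventually (\<lambda>N. \<forall>k\<in>{..<M}. coeff (p N) k = fps_nth f k) sequentially"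
      using coeff by (intro eventually_ball_finite) auto
    moreover have "eventually (\<lambda>N. M \<le> N) sequentially" by (rule eventually_ge_at_top)
    ultimately show "eventually (\<lambda>N. dist (disc_norm a r (p N) - disc_norm a r (trunc N f)) 0 < e)
        sequentially"
    proof eventually_elim
      case (elim N)
      have "\<bar>disc_norm a r (p N) - disc_norm a r (trunc N f)\<bar> \<le> C * s ^ M"
        using elim asm s fC bound C by (intro disc_norm_close) (auto simp: coeff_trunc)
      then show ?case using M by (simp add: dist_real_def)
    qed
  qed
  from tendsto_add[OF this zeta_trunc_tendsto[OF f asm]]
  show "(\<lambda>N. disc_norm a r (p N)) \<longlonglongrightarrow> zeta a r f" by simp
qed

lemma coeff_trunc_mult: "k < N \<Longrightarrow> coeff (trunc N f * trunc N g) k = fps_nth (f * g) k"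
  by (auto simp: coeff_mult fps_mult_nth coeff_trunc atLeast0AtMost intro!: sum.cong)

lemma
  assumes "f \<in> Hinf av" "g \<in> Hinf av"
  shows Hinf_mult: "f * g \<in> Hinf av"
    and zeta_mult: "\<lbrakk>0 \<le> r; r < 1; av a < 1\<rbrakk> \<Longrightarrow> zeta a r (f * g) = zeta a r f * zeta a r g"
proof -
  have 1: "eventually (\<lambda>N. coeff (trunc N f * trunc N g) k = fps_nth (f * g) k) sequentially" for k
    using eventually_gt_at_top[of k] by eventually_elim (rule coeff_trunc_mult)
  have 2: "av (coeff (trunc N f * trunc N g) k) \<le> Hinf_norm av f * Hinf_norm av g" for N k
  proof -
    have "av (coeff (trunc N f * trunc N g) k) \<le> gauss 1 (trunc N f) * gauss 1 (trunc N g)"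
      using gauss_1_coeff_le[of "trunc N f * trunc N g" k] by (simp add: gauss_mult)
    also have "\<dots> \<le> Hinf_norm av f * Hinf_norm av g"
      using assms by (intro mult_mono gauss_1_trunc_le Hinf_norm_nonneg gauss_nonneg) auto
    finally show ?thesis .
  qed
  show "f * g \<in> Hinf av" using 1 2 by (rule Hinf_if_approx)
  assume asm: "0 \<le> r" "r < 1" "av a < 1"
  have "(\<lambda>N. disc_norm a r (trunc N f) * disc_norm a r (trunc N g)) \<longlonglongrightarrow> zeta a r (f * g)"
    using zeta_tendsto(2)[OF 1 2 asm] asm by (simp add: disc_norm_mult)
  then show "zeta a r (f * g) = zeta a r f * zeta a r g"
    using tendsto_mult[OF zeta_trunc_tendsto zeta_trunc_tendsto, OF assms(1) asm assms(2) asm]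
      LIMSEQ_unique by blast
qed

lemma trunc_add: "trunc N (f + g) = trunc N f + trunc N g"
  by (rule poly_eqI) (simp add: coeff_trunc)

lemma Hinf_add:
  assumes "f \<in> Hinf av" "g \<in> Hinf av" shows "f + g \<in> Hinf av"
proof (rule HinfI)
  fix k show "av (fps_nth (f + g) k) \<le> max (Hinf_norm av f) (Hinf_norm av g)"
    using av_ultrametric[of "fps_nth f k" "fps_nth g k"]
      coeff_le_Hinf_norm[OF assms(1), of k] coeff_le_Hinf_norm[OF assms(2), of k] by simp
qed

lemma Hinf_fps_of_poly: "fps_of_poly p \<in> Hinf av"
  by (rule HinfI[of _ "gauss 1 p"]) (simp add: gauss_1_coeff_le)

lemma Hinf_const: "fps_const c \<in> Hinf av"
  using Hinf_fps_of_poly[of "[:c:]"] by (simp add: fps_of_poly_const)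

lemma Hinf_0: "0 \<in> Hinf av" and Hinf_1: "1 \<in> Hinf av"
  using Hinf_const[of 0] Hinf_const[of 1] by simp_all

lemma Hinf_uminus: "f \<in> Hinf av \<Longrightarrow> - f \<in> Hinf av"
  by (simp add: Hinf_def)

lemma zeta_fps_of_poly:
  assumes "0 \<le> r" "r < 1" "av a < 1" shows "zeta a r (fps_of_poly p) = disc_norm a r p"
  using zeta_tendsto(2)[of "\<lambda>_. p" "fps_of_poly p" "gauss 1 p" r a] assms
  by (simp add: gauss_1_coeff_le LIMSEQ_const_iff)

lemma zeta_const: "\<lbrakk>0 \<le> r; r < 1; av a < 1\<rbrakk> \<Longrightarrow> zeta a r (fps_const c) = av c"
  using zeta_fps_of_poly[of r a "[:c:]"] by (simp add: fps_of_poly_const)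

lemma zeta_add_le:
  assumes "f \<in> Hinf av" "g \<in> Hinf av" "0 \<le> r" "r < 1" "av a < 1"
  shows "zeta a r (f + g) \<le> max (zeta a r f) (zeta a r g)"
proof (rule LIMSEQ_le)
  show "(\<lambda>N. disc_norm a r (trunc N (f + g))) \<longlonglongrightarrow> zeta a r (f + g)"
    using assms by (intro zeta_trunc_tendsto Hinf_add)
  show "(\<lambda>N. max (disc_norm a r (trunc N f)) (disc_norm a r (trunc N g)))
      \<longlonglongrightarrow> max (zeta a r f) (zeta a r g)"
    using assms by (intro tendsto_max zeta_trunc_tendsto)
  show "\<exists>N. \<forall>n\<ge>N. disc_norm a r (trunc n (f + g))
      \<le> max (disc_norm a r (trunc n f)) (disc_norm a r (trunc n g))"
    using assms by (simp add: trunc_add disc_norm_add_le)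
qed

lemma zeta_nonneg:
  assumes "f \<in> Hinf av" "0 \<le> r" "r < 1" "av a < 1" shows "0 \<le> zeta a r f"
  using zeta_trunc_tendsto[OF assms] disc_norm_nonneg[OF assms(2)]
  by (intro LIMSEQ_le_const) auto

lemma zeta_le_norm:
  assumes "f \<in> Hinf av" "0 \<le> r" "r < 1" "av a < 1" shows "zeta a r f \<le> Hinf_norm av f"
proof (rule LIMSEQ_le_const2[OF zeta_trunc_tendsto[OF assms]])
  have "disc_norm a r (trunc N f) \<le> Hinf_norm av f" for N
    using disc_norm_le_gauss[of r 1 a "trunc N f"] gauss_1_trunc_le[OF assms(1), of N] assms by simp
  then show "\<exists>N. \<forall>n\<ge>N. disc_norm a r (trunc n f) \<le> Hinf_norm av f" by blast
qed

lemma zeta_mono: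
  assumes "f \<in> Hinf av" "0 \<le> r" "r \<le> s" "s < 1" "av a < 1" shows "zeta a r f \<le> zeta a s f"
  using assms
  by (intro LIMSEQ_le[OF zeta_trunc_tendsto zeta_trunc_tendsto] exI[of _ 0] allI impI disc_norm_mono)
    auto

text \<open>A disc of radius \<open>r \<ge> \<bar>a\<bar>\<close> about \<open>a\<close> is also a disc about \<open>0\<close>.\<close>

lemma zeta_ge_coeff:
  assumes "f \<in> Hinf av" "0 \<le> r" "r < 1" "av a \<le> r"
  shows "av (fps_nth f k) * r ^ k \<le> zeta a r f"
proof (rule LIMSEQ_le_const[OF zeta_trunc_tendsto])
  have "av (fps_nth f k) * r ^ k \<le> disc_norm a r (trunc n f)" if "Suc k \<le> n" for n
    using gauss_ge[of r "trunc n f" k] disc_norm_recentre[of r a 0 "trunc n f"] assms that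
    by (simp add: disc_norm_0_centre coeff_trunc)
  then show "\<exists>N. \<forall>n\<ge>N. av (fps_nth f k) * r ^ k \<le> disc_norm a r (trunc n f)" by blast
qed (use assms in auto)

lemma zeta_Lipschitz:
  assumes "f \<in> Hinf av" "0 \<le> r" "r \<le> s" "s \<le> t" "t < 1" "av a < 1"
  shows "zeta a s f \<le> zeta a r f + Hinf_norm av f / (1 - t) * (s - r)"
proof (rule LIMSEQ_le)
  show "(\<lambda>N. disc_norm a s (trunc N f)) \<longlonglongrightarrow> zeta a s f"
    using assms by (intro zeta_trunc_tendsto) auto
  show "(\<lambda>N. disc_norm a r (trunc N f) + Hinf_norm av f / (1 - t) * (s - r))
      \<longlonglongrightarrow> zeta a r f + Hinf_norm av f / (1 - t) * (s - r)"
    using assms by (intro tendsto_intros zeta_trunc_tendsto) auto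
  have "disc_norm a s (trunc N f) \<le> disc_norm a r (trunc N f) + Hinf_norm av f / (1 - t) * (s - r)"
    for N
  proof -
    have "gauss 1 (trunc N f) / (1 - t) * (s - r) \<le> Hinf_norm av f / (1 - t) * (s - r)"
      using assms by (intro mult_right_mono divide_right_mono gauss_1_trunc_le) auto
    then show ?thesis using disc_norm_Lipschitz[of r s t a "trunc N f"] assms by simp
  qed
  then show "\<exists>N. \<forall>n\<ge>N. disc_norm a s (trunc n f)
      \<le> disc_norm a r (trunc n f) + Hinf_norm av f / (1 - t) * (s - r)" by blast
qed

lemma continuous_on_zeta:
  assumes "f \<in> Hinf av" "av a < 1" shows "continuous_on {0..<1} (\<lambda>r. zeta a r f)"
proof -
  have "isCont (\<lambda>r. zeta a (max 0 r) f) x" if "x < 1" for x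
  proof -
    have "max 0 x < 1" using that by simp
    then obtain t where t: "max 0 x < t" "t < 1" using dense by blast
    define L where "L = Hinf_norm av f / (1 - t)"
    have L: "0 \<le> L" using t Hinf_norm_nonneg[OF assms(1)] by (simp add: L_def)
    have "L-lipschitz_on {..t} (\<lambda>r. zeta a (max 0 r) f)"
    proof (rule lipschitz_onI)
      have one: "\<bar>zeta a (max 0 s) f - zeta a (max 0 r) f\<bar> \<le> L * \<bar>s - r\<bar>"
        if "r \<le> s" "s \<le> t" for r s
      proof -
        have "zeta a (max 0 r) f \<le> zeta a (max 0 s) f"
          using that t assms by (intro zeta_mono) auto
        moreover have "zeta a (max 0 s) f \<le> zeta a (max 0 r) f + L * (max 0 s - max 0 r)"
          unfolding L_def using that t assms by (intro zeta_Lipschitz) auto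
        moreover have "L * (max 0 s - max 0 r) \<le> L * \<bar>s - r\<bar>"
          using L that by (intro mult_left_mono) auto
        ultimately show ?thesis by linarith
      qed
      fix r s assume "r \<in> {..t}" "s \<in> {..t}"
      then show "dist (zeta a (max 0 r) f) (zeta a (max 0 s) f) \<le> L * dist r s"
        using one[of r s] one[of s r] by (cases "r \<le> s") (auto simp: dist_real_def abs_minus_commute)
    qed (use L in auto)
    then have "continuous_on {..<t} (\<lambda>r. zeta a (max 0 r) f)"
      by (rule continuous_on_subset[OF lipschitz_on_continuous_on]) auto
    then show ?thesis using t by (simp add: continuous_on_eq_continuous_at)
  qed
  then have "continuous_on {0..<1} (\<lambda>r. zeta a (max 0 r) f)"
    by (intro continuous_at_imp_continuous_on) auto
  then show ?thesis by (rule continuous_on_eq) auto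
qed

lemma zeta_tendsto_norm:
  assumes "f \<in> Hinf av" "av a < 1"
  shows "((\<lambda>r. zeta a r f) \<longlongrightarrow> Hinf_norm av f) (at_left 1)"
proof (rule order_tendstoI)
  have ev: "eventually (\<lambda>r. max 0 (av a) < r \<and> r < 1) (at_left (1::real))"
    using assms eventually_at_left_real[of "max 0 (av a)" 1] by simp
  fix y assume y: "Hinf_norm av f < y"
  show "eventually (\<lambda>r. zeta a r f < y) (at_left 1)"
    using ev
  proof eventually_elim
    case (elim r)
    then show ?case using zeta_le_norm[OF assms(1), of r a] assms(2) y by simp
  qed
next
  have ev: "eventually (\<lambda>r. max 0 (av a) < r \<and> r < 1) (at_left (1::real))"
    using assms eventually_at_left_real[of "max 0 (av a)" 1] by simp
  fix y assume "y < Hinf_norm av f"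
  then obtain k where k: "y < av (fps_nth f k)"
    using Hinf_norm_leI[OF assms(1), of y] by (meson not_le)
  have "((\<lambda>r. av (fps_nth f k) * r ^ k) \<longlongrightarrow> av (fps_nth f k) * 1 ^ k) (at_left (1::real))"
    by (intro tendsto_intros)
  then have "eventually (\<lambda>r. y < av (fps_nth f k) * r ^ k) (at_left (1::real))"
    using k by (intro order_tendstoD) auto
  then show "eventually (\<lambda>r. y < zeta a r f) (at_left 1)"
    using ev
  proof eventually_elim
    case (elim r)
    then show ?case using zeta_ge_coeff[OF assms(1), of r a k] by simp
  qed
qed

lemma zeta_in_Berkovich:
  assumes "0 \<le> r" "r < 1" "av a < 1" shows "zeta a r \<in> Berkovich av"
proof -
  have "zeta a r \<in> Hinf av \<rightarrow>\<^sub>E {0..}"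
    using zeta_nonneg[OF _ assms] by (auto simp: zeta_def)
  moreover have "zeta a r 0 = 0" "zeta a r 1 = 1"
    using zeta_const[OF assms, of 0] zeta_const[OF assms, of 1] by simp_all
  moreover have "zeta a r (f + g) \<le> zeta a r f + zeta a r g" if "f \<in> Hinf av" "g \<in> Hinf av" for f g
    using zeta_add_le[OF that assms] zeta_nonneg[OF that(1) assms] zeta_nonneg[OF that(2) assms]
    by simp
  ultimately show ?thesis
    using zeta_mult[OF _ _ assms] zeta_le_norm[OF _ assms] by (simp add: Berkovich_def)
qed

text \<open>The Gauss norm is a limit of the multiplicative seminorms \<open>zeta 0 r\<close>.\<close>

lemma Hinf_norm_in_Berkovich: "Hinf_norm av \<in> Berkovich av"
proof -
  have lim: "((\<lambda>r. zeta 0 r f) \<longlongrightarrow> Hinf_norm av f) (at_left 1)" if "f \<in> Hinf av" for f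
    using that by (intro zeta_tendsto_norm) auto
  have ev: "eventually (\<lambda>r. 0 < r \<and> r < 1) (at_left (1::real))"
    using eventually_at_left_real[of 0 1] by simp
  have "Hinf_norm av \<in> Hinf av \<rightarrow>\<^sub>E {0..}"
    using Hinf_norm_nonneg by (auto simp: Hinf_norm_def)
  moreover have const: "Hinf_norm av (fps_const c) = av c" for c
  proof (rule tendsto_unique[OF _ lim[OF Hinf_const]])
    have "eventually (\<lambda>r. zeta 0 r (fps_const c) = av c) (at_left 1)"
      using ev by eventually_elim (simp add: zeta_const)
    then show "((\<lambda>r. zeta 0 r (fps_const c)) \<longlongrightarrow> av c) (at_left 1)"
      by (rule tendsto_eventually)
  qed simp
  moreover have "Hinf_norm av 0 = 0" "Hinf_norm av 1 = 1"
    using const[of 0] const[of 1] by simp_all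
  moreover have "Hinf_norm av (f * g) = Hinf_norm av f * Hinf_norm av g"
    if "f \<in> Hinf av" "g \<in> Hinf av" for f g
  proof (rule tendsto_unique[OF _ lim[OF Hinf_mult[OF that]]])
    have "eventually (\<lambda>r. zeta 0 r f * zeta 0 r g = zeta 0 r (f * g)) (at_left 1)"
      using ev by eventually_elim (simp add: zeta_mult that)
    then show "((\<lambda>r. zeta 0 r (f * g)) \<longlongrightarrow> Hinf_norm av f * Hinf_norm av g) (at_left 1)"
      by (rule Lim_transform_eventually[OF tendsto_mult[OF lim lim, OF that]])
  qed simp
  moreover have "Hinf_norm av (f + g) \<le> Hinf_norm av f + Hinf_norm av g"
    if "f \<in> Hinf av" "g \<in> Hinf av" for f g
  proof (rule tendsto_le[OF _ tendsto_add[OF lim lim, OF that] lim[OF Hinf_add[OF that]]])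
    show "eventually (\<lambda>r. zeta 0 r (f + g) \<le> zeta 0 r f + zeta 0 r g) (at_left 1)"
      using ev
    proof eventually_elim
      case (elim r)
      then have "zeta 0 r \<in> Berkovich av" by (intro zeta_in_Berkovich) auto
      then show ?case using that by (simp add: Berkovich_def)
    qed
  qed simp
  ultimately show ?thesis by (simp add: Berkovich_def)
qed

lemma Metric_space_av: "Metric_space UNIV (av_dist av)"
proof
  fix x y z :: 'a
  show "0 \<le> av_dist av x y" by (simp add: av_dist_def av_nonneg)
  show "av_dist av x y = av_dist av y x" by (simp add: av_dist_def av_minus_commute)
  show "av_dist av x y = 0 \<longleftrightarrow> x = y" by (simp add: av_dist_def av_eq_0_iff)
  show "av_dist av x z \<le> av_dist av x y + av_dist av y z"
    using av_ultrametric[of "x - y" "y - z"] av_nonneg[of "x - y"] av_nonneg[of "y - z"]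
    by (simp add: av_dist_def)
qed

lemma poly_trunc: "poly (trunc N f) a = (\<Sum>n<N. fps_nth f n * a ^ n)"
  by (simp add: trunc_def poly_sum poly_monom)

text \<open>The disc of radius \<open>0\<close> is the point itself.  Completeness of the field provides the value of the
  series.\<close>

lemma delta_eq_zeta:
  assumes f: "f \<in> Hinf av" and a: "av a < 1" shows "delta av a f = zeta a 0 f"
proof -
  interpret M: Metric_space UNIV "av_dist av" by (rule Metric_space_av)
  define S where "S N = poly (trunc N f) a" for N
  define C where "C = Hinf_norm av f"
  have close: "av (S m - S n) \<le> C * av a ^ e" if "e \<le> m" "e \<le> n" for e m n
  proof -
    have "disc_norm a 0 (trunc m f - trunc n f) \<le> C * av a ^ e"
      using that f a
      by (intro disc_norm_diff_close)
        (auto simp: C_def coeff_trunc coeff_le_Hinf_norm Hinf_norm_nonneg av_nonneg)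
    then show ?thesis by (simp add: disc_norm_0_radius S_def)
  qed
  have lim0: "(\<lambda>e. C * av a ^ e) \<longlonglongrightarrow> 0"
    using a av_nonneg by (auto intro!: tendsto_mult_right_zero LIMSEQ_realpow_zero)
  have "M.MCauchy S"
    unfolding M.MCauchy_def
  proof (intro conjI allI impI)
    fix e :: real assume "0 < e"
    then have "eventually (\<lambda>M. C * av a ^ M < e) sequentially"
      using order_tendstoD(2)[OF lim0] by blast
    then obtain M where "C * av a ^ M < e" by (auto simp: eventually_sequentially)
    then show "\<exists>N. \<forall>n n'. N \<le> n \<longrightarrow> N \<le> n' \<longrightarrow> av_dist av (S n) (S n') < e"
      unfolding av_dist_def using close by (intro exI[of _ M]) (auto intro: order_le_less_trans)
  qed auto
  then obtain w where w: "limitin M.mtopology S w sequentially"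
    using av_complete by (auto simp: M.mcomplete_def)
  have "S = (\<lambda>N. \<Sum>n<N. fps_nth f n * a ^ n)" by (simp add: S_def poly_trunc fun_eq_iff)
  then have "eval_at av f a = (THE w. limitin M.mtopology S w sequentially)"
    by (simp add: eval_at_def)
  also have "\<dots> = w"
    by (rule the_equality[where P = "\<lambda>w. limitin M.mtopology S w sequentially", OF w])
      (rule M.limitin_metric_unique[OF _ w trivial_limit_sequentially])
  finally have "eval_at av f a = w" .
  then have delta: "delta av a f = av w" using f by (simp add: delta_def)
  have "(\<lambda>N. av (S N)) \<longlonglongrightarrow> av w"
  proof (rule tendstoI)
    fix e :: real assume "0 < e"
    then have "eventually (\<lambda>N. av (S N - w) < e) sequentially"
      using w by (auto simp: M.limitin_metric av_dist_def)
    then show "eventually (\<lambda>N. dist (av (S N)) (av w) < e) sequentially"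
    proof eventually_elim
      case (elim N)
      have "av (S N) \<le> max (av (S N - w)) (av w)"
        using av_ultrametric[of "S N - w" w] by simp
      moreover have "av w \<le> max (av (S N)) (av (S N - w))"
        using av_diff_le[of "S N" "S N - w"] by simp
      ultimately show ?case
        using elim av_nonneg[of w] av_nonneg[of "S N"] av_nonneg[of "S N - w"] unfolding dist_real_def by linarith
    qed
  qed
  moreover have "(\<lambda>N. av (S N)) \<longlonglongrightarrow> zeta a 0 f"
    using zeta_trunc_tendsto[OF f, of 0 a] a by (simp add: disc_norm_0_radius S_def)
  ultimately have "av w = zeta a 0 f" by (rule LIMSEQ_unique)
  then show ?thesis using delta by simp
qed

end


section \<open>The Berkovich space\<close>

lemma
  assumes "\<phi> \<in> Berkovich av"
  shows Berkovich_ext: "\<phi> \<in> extensional (Hinf av)"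
    and Berkovich_0: "\<phi> 0 = 0" and Berkovich_1: "\<phi> 1 = 1"
    and Berkovich_nonneg: "f \<in> Hinf av \<Longrightarrow> 0 \<le> \<phi> f"
    and Berkovich_mult: "\<lbrakk>f \<in> Hinf av; g \<in> Hinf av\<rbrakk> \<Longrightarrow> \<phi> (f * g) = \<phi> f * \<phi> g"
    and Berkovich_add_le: "\<lbrakk>f \<in> Hinf av; g \<in> Hinf av\<rbrakk> \<Longrightarrow> \<phi> (f + g) \<le> \<phi> f + \<phi> g"
    and Berkovich_le_norm: "f \<in> Hinf av \<Longrightarrow> \<phi> f \<le> Hinf_norm av f"
  using assms by (auto simp: Berkovich_def PiE_iff)

lemma topspace_Berkovich [simp]: "topspace (Berkovich_topology av) = Berkovich av"
  by (auto simp: Berkovich_topology_def Berkovich_def PiE_def)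

lemma continuous_map_Berkovich_eval:
  "f \<in> Hinf av \<Longrightarrow> continuous_map (Berkovich_topology av) euclideanreal (\<lambda>\<phi>. \<phi> f)"
  unfolding Berkovich_topology_def
  by (intro continuous_map_from_subtopology continuous_map_product_projection)

lemma Hausdorff_Berkovich: "Hausdorff_space (Berkovich_topology av)"
  unfolding Berkovich_topology_def
  by (intro Hausdorff_space_subtopology) (simp add: Hausdorff_space_product_topology)

context alg_closed_nonarch_field
begin

text \<open>The Berkovich space is a closed subset of the product of the intervals from \<open>0\<close> to \<open>\<parallel>f\<parallel>\<close>.\<close>

lemma compact_Berkovich: "compact_space (Berkovich_topology av)"
proof -
  let ?P = "product_topology (\<lambda>_. euclideanreal) (Hinf av)"
  define B where "B = (\<Pi>\<^sub>E f\<in>Hinf av. {0..Hinf_norm av f})"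
  have B: "compactin ?P B" unfolding B_def by (simp add: compactin_PiE)
  have ev: "continuous_map ?P euclideanreal (\<lambda>\<phi>. \<phi> f)" if "f \<in> Hinf av" for f
    using that by (rule continuous_map_product_projection)
  define Mu where "Mu f g = {\<phi> \<in> topspace ?P. \<phi> (f * g) - \<phi> f * \<phi> g \<in> {0}}" for f g :: "'a fps"
  define Ad where "Ad f g = {\<phi> \<in> topspace ?P. \<phi> (f + g) - (\<phi> f + \<phi> g) \<in> {..0}}" for f g :: "'a fps"
  define Z where "Z = {\<phi> \<in> topspace ?P. \<phi> 0 \<in> {0}}"
  define O1 where "O1 = {\<phi> \<in> topspace ?P. \<phi> 1 \<in> {1}}"
  define C where "C = insert Z (insert O1 ((\<lambda>(f, g). Mu f g) ` (Hinf av \<times> Hinf av) \<union>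
      (\<lambda>(f, g). Ad f g) ` (Hinf av \<times> Hinf av)))"
  have "closedin ?P (Mu f g)" "closedin ?P (Ad f g)" if "f \<in> Hinf av" "g \<in> Hinf av" for f g
    unfolding Mu_def Ad_def
    using that Hinf_mult[OF that] Hinf_add[OF that] closed_closedin[of "{0::real}"] closed_closedin[of "{..0::real}"]
    by (intro closedin_continuous_map_preimage[where Y = euclideanreal] continuous_map_diff
        continuous_map_real_mult continuous_map_add ev; simp)+
  moreover have "closedin ?P Z" "closedin ?P O1"
    unfolding Z_def O1_def
    by (intro closedin_continuous_map_preimage[where Y = euclideanreal] ev Hinf_0 Hinf_1; simp)+
  ultimately have "closedin ?P (\<Inter> C)" by (intro closedin_Inter) (auto simp: C_def)
  then have "compactin ?P (B \<inter> \<Inter> C)" by (rule compact_Int_closedin[OF B])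
  moreover have "B \<inter> \<Inter> C = Berkovich av"
  proof (intro equalityI subsetI)
    fix \<phi> assume \<phi>: "\<phi> \<in> B \<inter> \<Inter> C"
    have 1: "\<phi> \<in> Z" "\<phi> \<in> O1" using \<phi> by (auto simp: C_def)
    have 2: "\<phi> \<in> Mu f g" "\<phi> \<in> Ad f g" if "f \<in> Hinf av" "g \<in> Hinf av" for f g
      using \<phi> that by (auto simp: C_def)
    show "\<phi> \<in> Berkovich av"
      using \<phi> 1 2 by (auto simp: Berkovich_def B_def Mu_def Ad_def Z_def O1_def PiE_iff)
  next
    fix \<phi> assume "\<phi> \<in> Berkovich av"
    then show "\<phi> \<in> B \<inter> \<Inter> C"
      by (auto simp: Berkovich_def B_def C_def Mu_def Ad_def Z_def O1_def PiE_iff)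
  qed
  ultimately show ?thesis
    by (simp add: Berkovich_topology_def compact_space_subtopology)
qed

lemma limitin_Berkovich:
  assumes "\<phi> \<in> Berkovich av" "eventually (\<lambda>i. \<Phi> i \<in> Berkovich av) F"
    and "\<And>f. f \<in> Hinf av \<Longrightarrow> ((\<lambda>i. \<Phi> i f) \<longlongrightarrow> \<phi> f) F"
  shows "limitin (Berkovich_topology av) \<Phi> \<phi> F"
  unfolding Berkovich_topology_def limitin_subtopology limitin_componentwise
proof (intro conjI)
  show "\<phi> \<in> extensional (Hinf av)" using assms(1) by (auto simp: Berkovich_def PiE_def)
  show "eventually (\<lambda>i. \<Phi> i \<in> topspace (product_topology (\<lambda>_. euclideanreal) (Hinf av))) F"
    using assms(2) by eventually_elim (auto simp: Berkovich_def PiE_def)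
qed (use assms in auto)

text \<open>The path does not contain the Gauss norm, which is its limit for \<open>r \<rightarrow> 1\<close>.\<close>

lemma connectedin_zeta_path:
  assumes "av a < 1"
  shows "connectedin (Berkovich_topology av) (zeta a ` {0..<1})"
proof (rule connectedin_continuous_map_image)
  show "continuous_map (top_of_set {0..<1}) (Berkovich_topology av) (zeta a)"
    unfolding Berkovich_topology_def continuous_map_in_subtopology continuous_map_componentwise
    using assms continuous_on_zeta[of _ a] zeta_in_Berkovich[of _ a]
    by (auto simp: zeta_def extensional_def)
  show "connectedin (top_of_set {0..<1}) {0..<1::real}"
    by (simp add: connectedin_subtopology)
qed

lemma delta_eq: "av a < 1 \<Longrightarrow> delta av a = zeta a 0"
  by (rule extensionalityI[of _ "Hinf av"]) (auto simp: delta_eq_zeta, auto simp: delta_def zeta_def)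

lemma delta_ultra_limit:
  assumes U: "nonprincipal_ultrafilter U" and z: "\<And>n. av (z n) < 1"
  shows "limitin (Berkovich_topology av) (\<lambda>n. zeta (z n) 0) (delta_ultra av z U) U"
proof -
  have z_in: "zeta (z n) 0 \<in> Berkovich av" for n using z by (intro zeta_in_Berkovich) auto
  obtain \<phi> where \<phi>: "limitin (Berkovich_topology av) (\<lambda>n. zeta (z n) 0) \<phi> U"
    using ultrafilter_limit_exists[OF U compact_Berkovich, of "\<lambda>n. zeta (z n) 0"] z_in by auto
  then have \<phi>B: "\<phi> \<in> Berkovich av" by (auto dest: limitin_topspace)
  have "\<phi> = delta_ultra av z U"
  proof (rule extensionalityI[of _ "Hinf av"])
    show "\<phi> \<in> extensional (Hinf av)" using \<phi>B by (auto simp: Berkovich_def PiE_def)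
    show "delta_ultra av z U \<in> extensional (Hinf av)" by (simp add: delta_ultra_def)
    fix f assume f: "f \<in> Hinf av"
    have "((\<lambda>n. zeta (z n) 0 f) \<longlongrightarrow> \<phi> f) U"
      using \<phi> f unfolding Berkovich_topology_def limitin_subtopology limitin_componentwise by simp
    then have "Lim U (\<lambda>n. zeta (z n) 0 f) = \<phi> f"
      using nonprincipal_ultrafilterD(1)[OF U] by (intro tendsto_Lim)
    then show "\<phi> f = delta_ultra av z U f"
      using f z by (simp add: delta_ultra_def delta_eq)
  qed
  then show ?thesis using \<phi> by simp
qed


section \<open>Infinite products\<close>

text \<open>Only finitely many factors contribute to a given coefficient, so that the product is defined
  coefficientwise by finite products.  No infinite sum is taken in the field.\<close>

lemma infinite_product:
  fixes F :: "nat \<Rightarrow> 'a poly" and m :: "nat \<Rightarrow> nat"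
  assumes m: "filterlim m at_top sequentially"
    and F: "\<And>n k. k < m n \<Longrightarrow> coeff (F n) k = coeff 1 k"
    and bound: "\<And>J. (\<Prod>n<J. gauss 1 (F n)) \<le> C"
  obtains G where "G \<in> Hinf av"
    "\<And>k. eventually (\<lambda>J. coeff (\<Prod>n<J. F n) k = fps_nth G k) sequentially"
    "\<And>a r. \<lbrakk>0 \<le> r; r < 1; av a < 1\<rbrakk> \<Longrightarrow> (\<lambda>J. \<Prod>n<J. disc_norm a r (F n)) \<longlonglongrightarrow> zeta a r G"
proof -
  define P where "P J = (\<Prod>n<J. F n)" for J
  have step: "coeff (P (Suc J)) k = coeff (P J) k" if "k < m J" for J k
  proof -
    have "coeff (P (Suc J)) k = (\<Sum>i\<le>k. coeff (P J) i * coeff (F J) (k - i))"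
      by (simp add: P_def coeff_mult)
    also have "\<dots> = (\<Sum>i\<le>k. coeff (P J) i * coeff 1 (k - i))"
      using that by (intro sum.cong) (auto simp: F)
    also have "\<dots> = coeff (P J) k" using coeff_mult[of "P J" 1 k] by (simp only: mult_1_right)
    finally show ?thesis .
  qed
  have "\<exists>c. eventually (\<lambda>J. coeff (P J) k = c) sequentially" for k
  proof -
    have "eventually (\<lambda>J. k < m J) sequentially"
      using eventually_compose_filterlim[OF eventually_gt_at_top m] .
    then obtain J0 where J0: "\<And>J. J0 \<le> J \<Longrightarrow> k < m J" by (auto simp: eventually_sequentially)
    have "coeff (P J) k = coeff (P J0) k" if "J0 \<le> J" for J
      using that by (induction rule: dec_induct) (auto simp: step J0)
    then show ?thesis unfolding eventually_sequentially by blast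
  qed
  then obtain c where c: "\<And>k. eventually (\<lambda>J. coeff (P J) k = c k) sequentially" by metis
  define G where "G = Abs_fps c"
  have 1: "eventually (\<lambda>J. coeff (P J) k = fps_nth G k) sequentially" for k
    using c by (simp add: G_def)
  have 2: "av (coeff (P J) k) \<le> C" for J k
  proof -
    have "gauss 1 (P J) = (\<Prod>n<J. gauss 1 (F n))"
      using disc_norm_prod[of 1 0 F "{..<J}"] by (simp add: P_def disc_norm_0_centre)
    then show ?thesis using gauss_1_coeff_le[of "P J" k] bound[of J] by linarith
  qed
  show ?thesis
  proof (rule that[of G])
    show "G \<in> Hinf av" using 1 2 by (rule Hinf_if_approx)
    show "eventually (\<lambda>J. coeff (\<Prod>n<J. F n) k = fps_nth G k) sequentially" for k
      using 1 by (simp add: P_def)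
    show "(\<lambda>J. \<Prod>n<J. disc_norm a r (F n)) \<longlonglongrightarrow> zeta a r G"
      if "0 \<le> r" "r < 1" "av a < 1" for a r
      using zeta_tendsto(2)[OF 1 2 that] that by (simp add: P_def disc_norm_prod)
  qed
qed

lemma coeff_power_eq_0:
  fixes p :: "'a poly"
  assumes "coeff p 0 = 0" "k < m" shows "coeff (p ^ m) k = 0"
proof -
  have "monom 1 1 dvd p" using assms(1) by (simp add: monom_1_dvd_iff')
  then have "monom 1 1 ^ m dvd p ^ m" by (rule dvd_power_same)
  then have "monom 1 m dvd p ^ m" by (simp add: monom_power)
  then show ?thesis using assms(2) by (simp add: monom_1_dvd_iff')
qed


section \<open>A bounded function vanishing on a regular sequence\<close>

lemma finite_inside_disc:
  assumes sum: "summable (\<lambda>n. if n \<in> D then ln (1 / av (z n)) else 0)"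
    and D: "\<And>n. n \<in> D \<Longrightarrow> 0 < av (z n)" and \<rho>: "\<rho> < 1"
  shows "finite {n \<in> D. av (z n) \<le> \<rho>}"
proof (cases "0 < \<rho>")
  case True
  define L where "L n = (if n \<in> D then ln (1 / av (z n)) else 0)" for n
  have "L \<longlonglongrightarrow> 0" unfolding L_def by (rule summable_LIMSEQ_zero[OF sum])
  moreover have "0 < ln (1 / \<rho>)" using True \<rho> by simp
  ultimately have "eventually (\<lambda>n. L n < ln (1 / \<rho>)) sequentially" by (rule order_tendstoD)
  then obtain N where N: "\<And>n. N \<le> n \<Longrightarrow> L n < ln (1 / \<rho>)" by (auto simp: eventually_sequentially)
  have "n < N" if "n \<in> D" "av (z n) \<le> \<rho>" for n
  proof (rule ccontr)
    assume "\<not> n < N"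
    then have "ln (1 / av (z n)) < ln (1 / \<rho>)" using N[of n] that by (simp add: L_def)
    then show False using D[OF that(1)] that(2) True by (simp add: ln_div)
  qed
  then have "{n \<in> D. av (z n) \<le> \<rho>} \<subseteq> {..<N}" by auto
  then show ?thesis by (rule finite_subset) simp
next
  case False
  then have "{n \<in> D. av (z n) \<le> \<rho>} = {}" using D by force
  then show ?thesis by (simp only: finite.emptyI)
qed

text \<open>The factor for \<open>z k\<close> of the product below is \<open>(1 - w) * geom_sum_top m b w\<close> with \<open>w = X / z k\<close>, that is
  \<open>1 + (b - 1) * w ^ m - b * w ^ Suc m\<close>.  It agrees with \<open>1\<close> up to order \<open>m\<close> for all \<open>b\<close>, so that \<open>b\<close> is free
  to keep the zeros of the second factor away from the given points.\<close>

definition geom_sum_top :: "nat \<Rightarrow> 'a \<Rightarrow> 'a \<Rightarrow> 'a" where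
  "geom_sum_top m b w = (\<Sum>i<m. w ^ i) + b * w ^ m"

text \<open>Each \<open>w\<close> excludes one residue class of coefficients \<open>b\<close>.\<close>

lemma ex_generic_coefficient:
  assumes fin: "finite S" and S: "\<And>w. w \<in> S \<Longrightarrow> av w = 1"
  shows "\<exists>b. av b = 1 \<and> (\<forall>w\<in>S. av (geom_sum_top m b w) = 1)"
proof -
  define c where "c w = - (\<Sum>i<m. w ^ i) / w ^ m" for w :: 'a
  have "av (c w) \<le> 1" if "w \<in> S" for w
  proof -
    have "av (\<Sum>i<m. w ^ i) \<le> 1" using S[OF that] by (intro av_sum_le) (auto simp: av_power)
    then show ?thesis using S[OF that] by (simp add: c_def av_divide av_power)
  qed
  then have "\<exists>b. \<forall>x\<in>insert 0 (c ` S). av (b - x) = 1"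
    using fin by (intro ex_av_diff_eq_1) auto
  then obtain b where b: "\<And>x. x \<in> insert 0 (c ` S) \<Longrightarrow> av (b - x) = 1" by blast
  have "av (geom_sum_top m b w) = 1" if "w \<in> S" for w
  proof -
    have w: "w ^ m \<noteq> 0" using S[OF that] by auto
    have "geom_sum_top m b w = (b - c w) * w ^ m"
      using w by (simp add: c_def geom_sum_top_def field_simps)
    then show ?thesis using b[of "c w"] S[OF that] that by (simp add: av_mult av_power)
  qed
  then show ?thesis using b[of 0] by auto
qed

text \<open>The constant term dominates for \<open>\<bar>w\<bar> < 1\<close>, the top term for \<open>\<bar>w\<bar> > 1\<close>; only \<open>\<bar>w\<bar> = 1\<close> depends on the
  choice of \<open>b\<close>.\<close>

lemma geom_sum_top_ge_1:
  assumes b: "av b = 1" and w: "av w = 1 \<Longrightarrow> av (geom_sum_top m b w) = 1"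
  shows "1 \<le> av (geom_sum_top m b w)"
proof (cases m)
  case 0
  then show ?thesis using b by (simp add: geom_sum_top_def)
next
  case (Suc k)
  consider "av w < 1" | "av w = 1" | "1 < av w" by linarith
  then show ?thesis
  proof cases
    case 1
    have "geom_sum_top m b w = w * geom_sum_top k b w + 1"
      unfolding Suc geom_sum_top_def
      by (simp add: sum.lessThan_Suc_shift sum_distrib_left distrib_left mult_ac del: sum.lessThan_Suc)
    moreover have "av (w * geom_sum_top k b w) < 1"
    proof -
      have "av (\<Sum>i<k. w ^ i) \<le> 1"
        using 1 by (intro av_sum_le) (auto simp: av_power av_nonneg power_le_one)
      moreover have "av (b * w ^ k) \<le> 1" using 1 b by (simp add: av_mult av_power av_nonneg power_le_one)
      ultimately have "av (geom_sum_top k b w) \<le> 1"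
        unfolding geom_sum_top_def using av_ultrametric[of "\<Sum>i<k. w ^ i" "b * w ^ k"] by linarith
      then have "av w * av (geom_sum_top k b w) \<le> av w * 1" using av_nonneg by (intro mult_left_mono) auto
      then show ?thesis using 1 by (simp add: av_mult)
    qed
    ultimately show ?thesis using av_add_eq_max[of "w * geom_sum_top k b w" 1] by simp
  next
    case 3
    have "av (\<Sum>i<m. w ^ i) \<le> av w ^ k"
      using 3 Suc by (intro av_sum_le) (auto simp: av_power intro!: power_increasing)
    also have "\<dots> < av w ^ m" using 3 Suc by simp
    finally have "av (geom_sum_top m b w) = av w ^ m"
      unfolding geom_sum_top_def using av_add_eq_max b by (simp add: av_mult av_power)
    then show ?thesis using 3 by (simp add: one_le_power)
  qed (use w in simp)
qed

text \<open>The zeros of the product are the \<open>z n\<close> and the zeros of the auxiliary factors.  The latter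
  are kept away from all \<open>z k\<close> by the choice of the leading coefficients, so that on a disc of radius
  \<open>r\<close> about \<open>z n\<close> the norm of the product is at least that of \<open>\<Prod>k. X - z k\<close>, which is at least
  \<open>r * (\<Prod>k\<noteq>n. \<bar>z n - z k\<bar>)\<close>.\<close>

lemma ex_vanishing_function:
  assumes D: "\<And>n. n \<in> D \<Longrightarrow> 0 < av (z n)" "\<And>n. n \<in> D \<Longrightarrow> av (z n) < 1"
    and sum: "summable (\<lambda>n. if n \<in> D then ln (1 / av (z n)) else 0)"
  obtains B where "B \<in> Hinf av" "\<And>n. n \<in> D \<Longrightarrow> zeta (z n) 0 B = 0"
    "\<And>n r \<delta>. \<lbrakk>n \<in> D; 0 \<le> r; r < 1; \<And>J. \<lbrakk>finite J; J \<subseteq> D - {n}\<rbrakk> \<Longrightarrow> \<delta> \<le> (\<Prod>k\<in>J. av (z n - z k))\<rbrakk>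
      \<Longrightarrow> r * \<delta> \<le> zeta (z n) r B"
proof -
  define L where "L n = (if n \<in> D then ln (1 / av (z n)) else 0)" for n
  have L: "0 \<le> L n" for n using D[of n] by (auto simp: L_def)
  have sumL: "summable L" using sum by (simp add: L_def[abs_def])
  obtain m :: "nat \<Rightarrow> nat" where m: "filterlim m at_top sequentially"
    and sum_m: "summable (\<lambda>n. real (m n)^2 * L n)"
    using summable_slow_weights[OF L sumL] by blast
  have "\<exists>b. av b = 1 \<and> (\<forall>n\<in>D. 1 \<le> av (geom_sum_top (m k) b (z n / z k)))" if k: "k \<in> D" for k
  proof -
    define S where "S = (\<lambda>n. z n / z k) ` {n \<in> D. av (z n) = av (z k)}"
    have "finite {n \<in> D. av (z n) \<le> av (z k)}"
      using D k by (intro finite_inside_disc[OF sum]) auto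
    then have "finite S"
      unfolding S_def by (intro finite_imageI) (rule finite_subset[rotated], auto)
    moreover have "av w = 1" if "w \<in> S" for w
      using that D(1)[OF k] by (auto simp: S_def av_divide)
    ultimately obtain b where b: "av b = 1" "\<And>w. w \<in> S \<Longrightarrow> av (geom_sum_top (m k) b w) = 1"
      using ex_generic_coefficient by metis
    have "1 \<le> av (geom_sum_top (m k) b (z n / z k))" if "n \<in> D" for n
    proof (rule geom_sum_top_ge_1[OF b(1)])
      assume "av (z n / z k) = 1"
      then have "av (z n) = av (z k)" using D(1)[OF k] by (simp add: av_divide field_simps)
      then show "av (geom_sum_top (m k) b (z n / z k)) = 1" using that by (intro b(2)) (auto simp: S_def)
    qed
    then show ?thesis using b(1) by blast
  qed
  then obtain b where b: "\<And>k. k \<in> D \<Longrightarrow> av (b k) = 1"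
    "\<And>k n. \<lbrakk>k \<in> D; n \<in> D\<rbrakk> \<Longrightarrow> 1 \<le> av (geom_sum_top (m k) (b k) (z n / z k))"
    by metis
  define u where "u k = [:0, 1 / z k:]" for k
  define T where "T k = (\<Sum>i<m k. u k ^ i) + [:b k:] * u k ^ m k" for k
  define F where "F k = (if k \<in> D then (1 - u k) * T k else 1)" for k
  have poly_T: "poly (T k) x = geom_sum_top (m k) (b k) (x / z k)" for k x
    by (simp add: T_def u_def geom_sum_top_def poly_sum)
  have norm_u: "gauss 1 (u k) = 1 / av (z k)" for k
  proof -
    have "u k = smult (1 / z k) [:- 0, 1:]" by (simp add: u_def)
    then have "disc_norm 0 1 (u k) = av (1 / z k) * disc_norm 0 1 [:- 0, 1:]"
      by (simp only: disc_norm_smult zero_le_one)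
    then show ?thesis using disc_norm_linear[of 1 0 0] by (simp add: disc_norm_0_centre av_divide)
  qed
  have lin: "disc_norm a r (1 - u k) = max (av (a - z k)) r / av (z k)"
    if "k \<in> D" "0 \<le> r" for a r k
  proof -
    have "z k \<noteq> 0" using D(1)[OF that(1)] by auto
    then have "1 - u k = smult (- 1 / z k) [:- z k, 1:]" by (simp add: u_def one_pCons)
    then have "disc_norm a r (1 - u k) = av (- 1 / z k) * disc_norm a r [:- z k, 1:]"
      using that by (simp only: disc_norm_smult)
    then show ?thesis using disc_norm_linear[OF that(2), of a "z k"]
      by (simp add: av_divide)
  qed
  have F_coeff: "coeff (F n) k = coeff 1 k" if "k < m n" for n k
  proof (cases "n \<in> D")
    case True
    have "F n = 1 + u n ^ m n * ((1 - u n) * [:b n:] - 1)"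
      using True one_diff_power_eq[of "u n" "m n"]
      by (simp add: F_def T_def algebra_simps)
    moreover have "monom 1 (m n) dvd u n ^ m n"
      using coeff_power_eq_0[of "u n" _ "m n"] by (simp add: monom_1_dvd_iff' u_def)
    then have "coeff (u n ^ m n * ((1 - u n) * [:b n:] - 1)) k = 0"
      using that dvd_mult2 monom_1_dvd_iff' by blast
    ultimately show ?thesis by simp
  qed (simp add: F_def)
  have F_norm: "gauss 1 (F n) \<le> exp ((real (m n) + 1) * L n)" for n
  proof (cases "n \<in> D")
    case True
    define M where "M = 1 / av (z n)"
    have M: "1 \<le> M" "M = exp (L n)" using D[OF True] True by (simp_all add: M_def L_def)
    have "disc_norm 0 1 (T n) \<le> M ^ m n"
    proof -
      have pow: "disc_norm 0 1 (u n ^ i) = M ^ i" for i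
        using norm_u[of n] disc_norm_power[of 1 0 "u n" i] unfolding disc_norm_0_centre M_def by simp
      have "disc_norm 0 1 (\<Sum>i<m n. u n ^ i) \<le> M ^ m n"
        using M by (intro disc_norm_sum_le) (auto simp: pow intro!: power_increasing)
      moreover have "disc_norm 0 1 ([:b n:] * u n ^ m n) \<le> M ^ m n"
        using b(1)[OF True] by (simp only: disc_norm_mult[OF zero_le_one] pow disc_norm_const)
      ultimately show ?thesis
        unfolding T_def using disc_norm_add_le[of 1 0 "\<Sum>i<m n. u n ^ i" "[:b n:] * u n ^ m n"]
        by linarith
    qed
    moreover have "disc_norm 0 1 (1 - u n) = M"
      using lin[OF True, of 1 0] D[OF True] by (simp add: M_def)
    ultimately have "disc_norm 0 1 (F n) \<le> M * M ^ m n"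
      using True M by (simp add: F_def disc_norm_mult)
    also have "\<dots> = exp ((real (m n) + 1) * L n)"
      unfolding M(2) by (simp add: exp_of_nat_mult[symmetric] exp_add[symmetric] algebra_simps)
    finally show ?thesis by (simp add: disc_norm_0_centre)
  qed (simp add: F_def L_def flip: disc_norm_0_centre)
  have sum': "summable (\<lambda>n. (real (m n) + 1) * L n)"
  proof (rule summable_comparison_test')
    show "summable (\<lambda>n. real (m n)^2 * L n + L n)" using sum_m sumL by (rule summable_add)
    fix n
    have "real (m n) \<le> real (m n) ^ 2"
      by (cases "m n") (auto simp: power2_eq_square)
    then have "real (m n) * L n \<le> real (m n) ^ 2 * L n" using L by (intro mult_right_mono)
    then show "norm ((real (m n) + 1) * L n) \<le> real (m n)^2 * L n + L n"
      using L[of n] by (simp add: algebra_simps)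
  qed
  have bound: "(\<Prod>n<J. gauss 1 (F n)) \<le> exp (\<Sum>n. (real (m n) + 1) * L n)" for J
    using F_norm L sum' by (intro prod_le_exp_suminf) (auto simp: gauss_nonneg)
  obtain B where B: "B \<in> Hinf av"
    "\<And>a r. \<lbrakk>0 \<le> r; r < 1; av a < 1\<rbrakk> \<Longrightarrow> (\<lambda>J. \<Prod>n<J. disc_norm a r (F n)) \<longlonglongrightarrow> zeta a r B"
    using infinite_product[OF m F_coeff bound] by metis
  show ?thesis
  proof (rule that[OF B(1)])
    fix n assume n: "n \<in> D"
    have "(\<Prod>k<J. disc_norm (z n) 0 (F k)) = 0" if "Suc n \<le> J" for J
    proof (rule prod_zero)
      have "disc_norm (z n) 0 (F n) = 0" using n lin[OF n, of 0 "z n"] by (simp add: F_def disc_norm_mult)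
      then show "\<exists>k\<in>{..<J}. disc_norm (z n) 0 (F k) = 0" using that by (intro bexI[of _ n]) auto
    qed simp
    then have "(\<lambda>J. \<Prod>k<J. disc_norm (z n) 0 (F k)) \<longlonglongrightarrow> 0"
      by (intro tendsto_eventually) (auto simp: eventually_sequentially)
    moreover have "(\<lambda>J. \<Prod>k<J. disc_norm (z n) 0 (F k)) \<longlonglongrightarrow> zeta (z n) 0 B"
      using D(2)[OF n] by (intro B(2)) auto
    ultimately show "zeta (z n) 0 B = 0" using LIMSEQ_unique by metis
  next
    fix n r \<delta>
    assume n: "n \<in> D" and r: "0 \<le> r" "r < (1::real)"
      and \<delta>: "\<And>J. \<lbrakk>finite J; J \<subseteq> D - {n}\<rbrakk> \<Longrightarrow> \<delta> \<le> (\<Prod>k\<in>J. av (z n - z k))"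
    have ge: "(if k \<in> D then if k = n then r else av (z n - z k) else 1) \<le> disc_norm (z n) r (F k)" for k
    proof (cases "k \<in> D")
      case True
      have "1 \<le> disc_norm (z n) r (T k)"
        using poly_le_disc_norm[OF r(1), of "T k" "z n"] b(2)[OF True n] by (simp add: poly_T)
      moreover have "max (av (z n - z k)) r \<le> disc_norm (z n) r (1 - u k)"
        unfolding lin[OF True r(1)] pos_le_divide_eq[OF D(1)[OF True]]
        using D[OF True] r by (intro mult_left_le) (auto simp: le_max_iff_disj)
      ultimately have "max (av (z n - z k)) r * 1 \<le> disc_norm (z n) r (1 - u k) * disc_norm (z n) r (T k)"
        using r by (intro mult_mono disc_norm_nonneg) (auto simp: le_max_iff_disj)
      then show ?thesis using True r by (auto simp: F_def disc_norm_mult)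
    qed (simp add: F_def)
    have "r * \<delta> \<le> (\<Prod>k<J. disc_norm (z n) r (F k))" if "Suc n \<le> J" for J
    proof -
      define J' where "J' = {k \<in> {..<J} - {n}. k \<in> D}"
      have "r * \<delta> \<le> r * (\<Prod>k\<in>J'. av (z n - z k))"
        using r by (intro mult_left_mono \<delta>) (auto simp: J'_def)
      also have "(\<Prod>k\<in>J'. av (z n - z k)) = (\<Prod>k\<in>{..<J} - {n}. if k \<in> D then av (z n - z k) else 1)"
        unfolding J'_def by (rule prod.inter_filter) simp
      also have "\<dots> = (\<Prod>k\<in>{..<J} - {n}. if k \<in> D then if k = n then r else av (z n - z k) else 1)"
        by (intro prod.cong) auto
      also have "r * \<dots> = (\<Prod>k<J. if k \<in> D then if k = n then r else av (z n - z k) else 1)"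
        using that n by (subst (2) prod.remove[of _ n]) auto
      also have "\<dots> \<le> (\<Prod>k<J. disc_norm (z n) r (F k))"
        using ge r by (intro prod_mono) (auto simp: av_nonneg)
      finally show ?thesis .
    qed
    then show "r * \<delta> \<le> zeta (z n) r B"
      using D(2)[OF n] r by (intro LIMSEQ_le_const[OF B(2)]) auto
  qed
qed

text \<open>The points closer to \<open>0\<close> than a fixed \<open>z n0\<close> all have distance \<open>\<bar>z n0\<bar> < 1\<close> from it, so there are finitely
  many of them; the others satisfy \<open>\<bar>z n0 - z k\<bar> \<le> \<bar>z k\<bar>\<close>.  This turns the separation condition at \<open>n0\<close> into
  the convergence of \<open>\<Sum>k. ln (1 / \<bar>z k\<bar>)\<close>.\<close>

lemma regular_seqE:
  assumes U: "nonprincipal_ultrafilter U" and z: "\<And>n. av (z n) < 1" and reg: "regular_seq av z U"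
  obtains D \<delta> where "eventually (\<lambda>n. n \<in> D) U" "\<And>n. n \<in> D \<Longrightarrow> 0 < av (z n)" "0 < \<delta>"
    "summable (\<lambda>n. if n \<in> D then ln (1 / av (z n)) else 0)"
    "\<And>n J. \<lbrakk>n \<in> D; finite J; J \<subseteq> D - {n}\<rbrakk> \<Longrightarrow> \<delta> \<le> (\<Prod>k\<in>J. av (z n - z k))"
proof -
  obtain C where C: "eventually (\<lambda>n. n \<in> C) U" "0 < (INF n\<in>C. separation_prod av z C n)"
    using reg by (auto simp: regular_seq_def)
  define \<delta> where "\<delta> = (INF n\<in>C. separation_prod av z C n)"
  have \<delta>: "0 < \<delta>" using C by (simp add: \<delta>_def)
  have le1: "av (z n - z k) \<le> 1" for n k
    using av_diff_le[of "z n" "z k"] z[of n] z[of k] by simp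
  define p where "p n N = (\<Prod>m\<in>{m\<in>C. m \<noteq> n \<and> m < N}. av (z n - z m))" for n N
  have p_nonneg: "0 \<le> p n N" for n N by (auto simp: p_def intro!: prod_nonneg av_nonneg)
  have p_dec: "p n N' \<le> p n N" if "N \<le> N'" for n N N'
    unfolding p_def using that le1 by (intro prod_antimono_subset) (auto simp: av_nonneg)
  have lim: "p n \<longlonglongrightarrow> separation_prod av z C n" for n
  proof -
    have dec: "decseq (p n)" using p_dec by (simp add: decseq_def)
    obtain L where "p n \<longlonglongrightarrow> L"
      by (rule decseq_convergent[OF dec, of 0]) (use p_nonneg in auto)
    then have "convergent (p n)" by (rule convergentI)
    then show ?thesis by (simp add: convergent_LIMSEQ_iff separation_prod_def p_def[abs_def])
  qed
  have sep_nonneg: "0 \<le> separation_prod av z C n" for n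
    by (rule LIMSEQ_le_const[OF lim]) (use p_nonneg in auto)
  have sep: "\<delta> \<le> p n N" if "n \<in> C" for n N
  proof -
    have "\<delta> \<le> separation_prod av z C n"
      unfolding \<delta>_def using sep_nonneg that by (intro cINF_lower bdd_belowI2[of _ 0]) auto
    also have "\<dots> \<le> p n N"
      by (rule LIMSEQ_le_const2[OF lim]) (use p_dec in blast)
    finally show ?thesis .
  qed
  have prod: "\<delta> \<le> (\<Prod>k\<in>J. av (z n - z k))" if n: "n \<in> C" and J: "finite J" "J \<subseteq> C - {n}" for n J
  proof -
    obtain N where N: "\<And>k. k \<in> J \<Longrightarrow> k < N" using J(1) finite_nat_set_iff_bounded by auto
    have "p n N \<le> (\<Prod>k\<in>J. av (z n - z k))"
      unfolding p_def using J N le1 by (intro prod_antimono_subset) (auto simp: av_nonneg)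
    then show ?thesis using sep[OF n, of N] by linarith
  qed
  obtain n0 where n0: "n0 \<in> C"
    using eventually_happens[OF C(1)] nonprincipal_ultrafilterD(1)[OF U] by blast
  define D where "D = {n \<in> C. av (z n0) \<le> av (z n) \<and> z n \<noteq> 0}"
  have finite_rest: "finite {n \<in> C - {n0}. av (z n) < av (z n0)}"
  proof (rule ccontr)
    assume inf: "infinite {n \<in> C - {n0}. av (z n) < av (z n0)}"
    obtain k where k: "av (z n0) ^ k < \<delta>" using real_arch_pow_inv[OF \<delta> z] by blast
    obtain J where J: "finite J" "card J = k" "J \<subseteq> {n \<in> C - {n0}. av (z n) < av (z n0)}"
      using infinite_arbitrarily_large[OF inf] by blast
    have "\<delta> \<le> (\<Prod>k\<in>J. av (z n0 - z k))" using J n0 by (intro prod) auto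
    also have "\<dots> = (\<Prod>k\<in>J. av (z n0))"
      using J(3) by (intro prod.cong) (auto simp: av_diff_eq_max)
    also have "\<dots> = av (z n0) ^ k" using J by simp
    finally show False using k by linarith
  qed
  have sub: "C - D \<subseteq> insert n0 {n \<in> C - {n0}. av (z n) < av (z n0)}"
  proof
    fix n assume n: "n \<in> C - D"
    show "n \<in> insert n0 {n \<in> C - {n0}. av (z n) < av (z n0)}"
    proof (cases "n = n0 \<or> av (z n) < av (z n0)")
      case False
      then have "z n = 0" using n by (auto simp: D_def)
      then have "z n0 = 0" using False av_nonneg[of "z n0"] av_eq_0_iff by force
      then have "(\<Prod>k\<in>{n}. av (z n0 - z k)) = 0" using \<open>z n = 0\<close> by simp
      then show ?thesis using prod[OF n0, of "{n}"] n False \<delta> by simp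
    qed (use n in auto)
  qed
  then have "finite (C - D)" using finite_rest by (meson finite.insertI finite_subset)
  then have "eventually (\<lambda>n. n \<notin> C - D) cofinite" by (simp only: eventually_cofinite not_not Collect_mem_eq)
  then have "eventually (\<lambda>n. n \<notin> C - D) U"
    by (intro nonprincipal_ultrafilter_le_sequentially[OF U]) (simp only: cofinite_eq_sequentially)
  then have ev: "eventually (\<lambda>n. n \<in> D) U" using C(1) by eventually_elim blast
  have pos: "0 < av (z n)" if "n \<in> D" for n using that by (auto simp: D_def av_pos)
  have "summable (\<lambda>n. if n \<in> D - {n0} then ln (1 / av (z n)) else 0)"
  proof (rule summableI_nonneg_bounded)
    show "0 \<le> (if n \<in> D - {n0} then ln (1 / av (z n)) else 0)" for n
      using pos[of n] z[of n] by auto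
    fix N
    let ?J = "{n \<in> {..<N}. n \<in> D - {n0}}"
    have "\<delta> \<le> (\<Prod>k\<in>?J. av (z n0 - z k))" using n0 by (intro prod) (auto simp: D_def)
    also have "\<dots> \<le> (\<Prod>k\<in>?J. av (z k))"
      using av_diff_le by (intro prod_mono) (fastforce simp: av_nonneg D_def max_def split: if_splits)
    finally have "ln \<delta> \<le> ln (\<Prod>k\<in>?J. av (z k))" using \<delta> by simp
    also have "\<dots> = (\<Sum>k\<in>?J. ln (av (z k)))" using pos by (intro ln_prod) force+
    finally have "(\<Sum>k\<in>?J. ln (1 / av (z k))) \<le> - ln \<delta>"
      by (simp only: inverse_eq_divide[symmetric] ln_inverse sum_negf neg_le_iff_le)
    then show "(\<Sum>n<N. if n \<in> D - {n0} then ln (1 / av (z n)) else 0) \<le> - ln \<delta>"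
      by (simp only: sum.inter_filter[OF finite_lessThan])
  qed
  moreover have ev_eq: "eventually (\<lambda>n. (if n \<in> D - {n0} then ln (1 / av (z n)) else 0) =
      (if n \<in> D then ln (1 / av (z n)) else 0)) sequentially"
    using eventually_gt_at_top[of n0] by eventually_elim auto
  ultimately have "summable (\<lambda>n. if n \<in> D then ln (1 / av (z n)) else 0)"
    using summable_cong[OF ev_eq] by simp
  then show ?thesis
    using that[OF ev pos \<delta>] prod by (auto simp: D_def)
qed


section \<open>A bounded function decaying where a given one is not maximal\<close>

text \<open>If \<open>Q\<close> has the value \<open>1\<close> at \<open>0\<close>, this is a multiple of \<open>Q ^ m\<close> that agrees with \<open>1\<close> up to order \<open>m\<close>:
  \<open>Q\<close> divides \<open>1 - (1 - Q) ^ m\<close>, and \<open>1 - Q\<close> vanishes at \<open>0\<close>.\<close>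

definition flat_power :: "nat \<Rightarrow> 'a poly \<Rightarrow> 'a poly" where
  "flat_power m Q = (1 - (1 - Q) ^ m) ^ m"

lemma coeff_flat_power:
  assumes "coeff Q 0 = 1" "k < m" shows "coeff (flat_power m Q) k = coeff 1 k"
proof -
  have m: "monom 1 m dvd (1 - Q) ^ m"
    using assms(1) coeff_power_eq_0[of "1 - Q" _ m] by (simp add: monom_1_dvd_iff')
  have "monom 1 m dvd flat_power m Q - 1"
  proof -
    have "flat_power m Q - 1 = - ((1 - Q) ^ m) * (\<Sum>i<m. (1 - (1 - Q) ^ m) ^ i)"
      unfolding flat_power_def by (subst power_diff_1_eq) simp
    then show ?thesis using m by (simp add: dvd_mult2)
  qed
  then have "coeff (flat_power m Q - 1) k = 0" using assms(2) by (simp add: monom_1_dvd_iff')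
  then show ?thesis by simp
qed

lemma disc_norm_flat_power:
  assumes r: "0 \<le> r" "r \<le> 1" "av a \<le> 1" and Q: "gauss 1 Q \<le> M" "1 \<le> M"
  shows "disc_norm a r (flat_power m Q) \<le> disc_norm a r Q ^ m * M ^ (m ^ 2)"
    and "disc_norm a r (flat_power m Q) \<le> M ^ (m ^ 2)"
proof -
  have 1: "disc_norm a r Q \<le> M" 
    using disc_norm_le_gauss[of r 1 a Q] r Q by linarith
  have 2: "disc_norm a r (1 - Q) \<le> M"
    using disc_norm_diff_le[OF r(1), of a 1 Q] 1 Q by simp
  have pow: "disc_norm a r ((1 - Q) ^ j) \<le> M ^ j" for j
    using 2 r by (simp add: disc_norm_power power_mono disc_norm_nonneg)
  have "disc_norm a r (1 - (1 - Q) ^ m) \<le> max 1 (M ^ m)"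
    using disc_norm_diff_le[OF r(1), of a 1 "(1 - Q) ^ m"] pow[of m] by simp
  then have "disc_norm a r (1 - (1 - Q) ^ m) \<le> M ^ m" using Q by simp
  then have "disc_norm a r (1 - (1 - Q) ^ m) ^ m \<le> (M ^ m) ^ m"
    using r by (intro power_mono disc_norm_nonneg)
  then show "disc_norm a r (flat_power m Q) \<le> M ^ (m ^ 2)"
    using r by (simp add: flat_power_def disc_norm_power power2_eq_square power_mult)
  define T where "T = (\<Sum>j<m. (1 - Q) ^ j)"
  have T: "1 - (1 - Q) ^ m = Q * T"
    unfolding T_def using one_diff_power_eq[of "1 - Q" m] by simp
  have "disc_norm a r T \<le> M ^ m"
    unfolding T_def
  proof (rule disc_norm_sum_le[OF r(1)])
    fix j assume "j \<in> {..<m}"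
    then have "M ^ j \<le> M ^ m" using Q by (intro power_increasing) auto
    then show "disc_norm a r ((1 - Q) ^ j) \<le> M ^ m" using pow[of j] by simp
  qed (use Q in simp)
  then have "disc_norm a r Q * disc_norm a r T \<le> disc_norm a r Q * M ^ m"
    using r by (intro mult_left_mono disc_norm_nonneg)
  then have "(disc_norm a r Q * disc_norm a r T) ^ m \<le> (disc_norm a r Q * M ^ m) ^ m"
    using r by (intro power_mono mult_nonneg_nonneg disc_norm_nonneg)
  then show "disc_norm a r (flat_power m Q) \<le> disc_norm a r Q ^ m * M ^ (m ^ 2)"
    using r by (simp add: flat_power_def T disc_norm_power disc_norm_mult power_mult_distrib
        power2_eq_square power_mult)
qed

text \<open>A form of Jensen's inequality: for a polynomial with roots \<open>W\<close>, the right-hand side is the Gauss norm and the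
  second product on the left-hand side the value at \<open>0\<close>, up to the leading coefficient.\<close>

lemma prod_mset_roots_le:
  assumes W: "\<And>w. w \<in># W \<Longrightarrow> w \<noteq> 0" and S: "finite S" "S \<subseteq> {0<..<1}"
  shows "(\<Prod>\<rho>\<in>S. (1 / \<rho>) ^ size (filter_mset (\<lambda>w. av w = \<rho>) W)) * (\<Prod>w\<in>#W. av w)
    \<le> (\<Prod>w\<in>#W. max (av w) 1)"
  using W
proof (induction W)
  case (add w W)
  define p where "p V = (\<Prod>\<rho>\<in>S. (1 / \<rho>) ^ size (filter_mset (\<lambda>w. av w = \<rho>) V))" for V
  have IH: "p W * (\<Prod>w\<in>#W. av w) \<le> (\<Prod>w\<in>#W. max (av w) 1)" using add by (simp add: p_def)
  have w: "0 < av w" using add.prems[of w] by (simp add: av_pos)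
  have nonneg: "0 \<le> p W * (\<Prod>w\<in>#W. av w)"
  proof (intro mult_nonneg_nonneg)
    show "0 \<le> p W" unfolding p_def using S by (intro prod_nonneg zero_le_power) auto
    show "0 \<le> (\<Prod>w\<in>#W. av w)" by (induction W) (auto simp: av_nonneg)
  qed
  have step: "p (add_mset w W) = p W * (if av w \<in> S then 1 / av w else 1)"
  proof -
    have "p (add_mset w W) = (\<Prod>\<rho>\<in>S. (1 / \<rho>) ^ size (filter_mset (\<lambda>w. av w = \<rho>) W) *
        (if \<rho> = av w then 1 / av w else 1))"
      unfolding p_def by (intro prod.cong) (auto simp: power_Suc2)
    also have "\<dots> = p W * (\<Prod>\<rho>\<in>S. if \<rho> = av w then 1 / av w else 1)"
      by (simp add: p_def prod.distrib)
    also have "(\<Prod>\<rho>\<in>S. if \<rho> = av w then 1 / av w else 1) = (if av w \<in> S then 1 / av w else 1)"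
      using S(1) by (simp add: prod.delta)
    finally show ?thesis .
  qed
  have "(if av w \<in> S then 1 / av w else 1) * av w \<le> max (av w) 1" using w by auto
  then have "(p W * (\<Prod>w\<in>#W. av w)) * ((if av w \<in> S then 1 / av w else 1) * av w)
      \<le> (\<Prod>w\<in>#W. max (av w) 1) * max (av w) 1"
    using IH nonneg w by (intro mult_mono) auto
  then show ?case using step by (simp add: p_def mult_ac)
qed simp

definition unit_factors :: "'a multiset \<Rightarrow> 'a poly" where
  "unit_factors W = (\<Prod>w\<in>#W. [:1, - 1 / w:])"

lemma coeff_unit_factors: "coeff (unit_factors W) 0 = 1"
proof -
  have "poly (unit_factors W) 0 = 1" unfolding unit_factors_def by (induction W) auto
  then show ?thesis by (simp add: poly_0_coeff_0)
qed

lemma disc_norm_unit_factors: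
  assumes "\<And>w. w \<in># W \<Longrightarrow> w \<noteq> 0" "0 \<le> r"
  shows "disc_norm a r (unit_factors W) = (\<Prod>w\<in>#W. max (av (a - w)) r / av w)"
proof -
  have "disc_norm a r [:1, - 1 / w:] = max (av (a - w)) r / av w" if "w \<in># W" for w
  proof -
    have "[:1, - 1 / w:] = smult (- 1 / w) [:- w, 1:]" using assms(1)[OF that] by simp
    then have "disc_norm a r [:1, - 1 / w:] = av (- 1 / w) * disc_norm a r [:- w, 1:]"
      using assms(2) by (simp only: disc_norm_smult)
    then show ?thesis using assms(2) by (simp add: disc_norm_linear av_divide)
  qed
  then show ?thesis
    using assms(2) unfolding unit_factors_def disc_norm_prod_mset[OF assms(2)]
    by (intro arg_cong[of _ _ prod_mset] image_mset_cong)
qed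

text \<open>On a disc about a point \<open>a\<close> of absolute value \<open>\<rho>\<close>, the linear factors belonging to roots
  \<open>w\<close> with \<open>\<bar>w\<bar> \<noteq> \<rho>\<close> are at least as large as on the circle of radius \<open>\<rho>\<close>.\<close>

lemma disc_norm_ge_unit_factors:
  assumes W: "\<And>w. w \<in># W \<Longrightarrow> w \<noteq> 0" and a: "av a = \<rho>" "0 < \<rho>" and r: "0 \<le> r"
    and p: "p = smult c (\<Prod>w\<in>#W. [:- w, 1:])"
  shows "gauss \<rho> p * disc_norm a r (unit_factors (filter_mset (\<lambda>w. av w = \<rho>) W)) \<le> disc_norm a r p"
proof -
  let ?f = "\<lambda>w. if av w = \<rho> then max (av (a - w)) r / av w else 1"
  have "(\<Prod>w\<in>#W. max (av w) \<rho>) * (\<Prod>w\<in>#W. ?f w) = (\<Prod>w\<in>#W. max (av w) \<rho> * ?f w)"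
    by (simp add: prod_mset.distrib)
  also have "\<dots> \<le> (\<Prod>w\<in>#W. max (av (a - w)) r)"
  proof (rule prod_mset_mono_real)
    fix w
    show "0 \<le> max (av w) \<rho> * ?f w" using a r by (auto simp: le_max_iff_disj av_nonneg)
    show "max (av w) \<rho> * ?f w \<le> max (av (a - w)) r"
    proof (cases "av w = \<rho>")
      case False
      then have "av (a - w) = max (av w) \<rho>" using a av_diff_eq_max[of a w] by (simp add: max.commute)
      then show ?thesis using False by simp
    qed (use a in simp)
  qed
  finally have "av c * ((\<Prod>w\<in>#W. max (av w) \<rho>) * (\<Prod>w\<in>#W. ?f w))
      \<le> av c * (\<Prod>w\<in>#W. max (av (a - w)) r)"
    by (intro mult_left_mono av_nonneg)
  moreover have "gauss \<rho> p = av c * (\<Prod>w\<in>#W. max (av w) \<rho>)"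
    using disc_norm_root_product[of \<rho> 0 c W] a unfolding p by (simp add: disc_norm_0_centre)
  moreover have "disc_norm a r (unit_factors (filter_mset (\<lambda>w. av w = \<rho>) W)) = (\<Prod>w\<in>#W. ?f w)"
    unfolding prod_mset_filter_if[symmetric] using W r by (intro disc_norm_unit_factors) auto
  ultimately show ?thesis
    using disc_norm_root_product[OF r, of a c W] unfolding p by (simp add: mult.assoc)
qed

text \<open>The polynomials \<open>Q \<rho>\<close> stand for the linear factors of \<open>f\<close> on the circle of radius \<open>\<rho>\<close>.  They are
  taken from truncations of \<open>f\<close>, chosen for each \<open>\<rho>\<close> such that the number of roots on the circle is at
  most its limes inferior; then the Jensen-type bound for finitely many circles, which holds
  for each truncation, carries over to the chosen counts.\<close>

lemma ex_circle_factors: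
  assumes f: "f \<in> Hinf av" "fps_nth f 0 \<noteq> 0" and \<eta>: "0 \<le> \<eta>" "\<eta> < Hinf_norm av f"
  obtains Q M K \<rho>0 q where "0 \<le> q" "q < 1" "0 < \<rho>0" "\<rho>0 < 1"
    "\<And>\<rho>. coeff (Q \<rho>) 0 = 1"
    "\<And>\<rho>. \<lbrakk>\<rho>0 \<le> \<rho>; \<rho> < 1\<rbrakk> \<Longrightarrow> gauss 1 (Q \<rho>) \<le> M \<rho>"
    "\<And>\<rho>. \<lbrakk>\<rho>0 \<le> \<rho>; \<rho> < 1\<rbrakk> \<Longrightarrow> 1 \<le> M \<rho>"
    "\<And>S. \<lbrakk>finite S; S \<subseteq> {\<rho>0..<1}\<rbrakk> \<Longrightarrow> (\<Sum>\<rho>\<in>S. ln (M \<rho>)) \<le> K"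
    "\<And>\<rho> a r. \<lbrakk>\<rho>0 \<le> \<rho>; \<rho> < 1; av a = \<rho>; 0 \<le> r; r < 1; zeta a r f \<le> \<eta>\<rbrakk> \<Longrightarrow> disc_norm a r (Q \<rho>) \<le> q"
proof -
  define P where "P N = trunc (Suc N) f" for N
  have coeff0: "coeff (P N) 0 = fps_nth f 0" for N by (simp add: P_def coeff_trunc)
  have "\<exists>c W. P N = smult c (\<Prod>w\<in>#W. [:- w, 1:])" for N
  proof -
    have "P N \<noteq> 0" using f(2) coeff0[of N] by force
    from alg_closed_imp_factorization[OF this] show ?thesis by blast
  qed
  then obtain W c where W: "\<And>N. P N = smult (c N) (\<Prod>w\<in>#W N. [:- w, 1:])"
    by metis
  have val0: "av (c N) * (\<Prod>w\<in>#W N. av w) = av (fps_nth f 0)" for N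
  proof -
    have "disc_norm 0 0 (P N) = av (c N) * (\<Prod>w\<in>#W N. max (av (0 - w)) 0)"
      unfolding W[of N] by (rule disc_norm_root_product) simp
    then show ?thesis using coeff0[of N]
      by (simp add: disc_norm_0_radius poly_0_coeff_0 max_absorb1 av_nonneg)
  qed
  have f0: "0 < av (fps_nth f 0)" using f(2) by (rule av_pos)
  have W0: "w \<noteq> 0" if w: "w \<in># W N" for w N
  proof
    assume "w = 0"
    moreover obtain V where "W N = add_mset w V" using multi_member_split[OF w] by blast
    ultimately have "(\<Prod>w\<in>#W N. av w) = 0" by simp
    then have "av (fps_nth f 0) = 0" using val0[of N] by (metis mult_zero_right)
    then show False using f0 by simp
  qed
  define cnt where "cnt N \<rho> = size (filter_mset (\<lambda>w. av w = \<rho>) (W N))" for N \<rho>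
  define R where "R = Hinf_norm av f / av (fps_nth f 0)"
  have cnt_le: "(\<Prod>\<rho>\<in>S. (1 / \<rho>) ^ cnt N \<rho>) \<le> R" if "finite S" "S \<subseteq> {0<..<1}" for S N
  proof -
    have "(\<Prod>\<rho>\<in>S. (1 / \<rho>) ^ cnt N \<rho>) * av (fps_nth f 0)
        = av (c N) * ((\<Prod>\<rho>\<in>S. (1 / \<rho>) ^ cnt N \<rho>) * (\<Prod>w\<in>#W N. av w))"
      unfolding val0[of N, symmetric] by simp
    also have "\<dots> \<le> av (c N) * (\<Prod>w\<in>#W N. max (av w) 1)"
      unfolding cnt_def using W0 that by (intro mult_left_mono prod_mset_roots_le av_nonneg)
    also have "\<dots> = gauss 1 (P N)"
      using disc_norm_root_product[of 1 0 "c N" "W N"] by (simp add: W[of N] disc_norm_0_centre)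
    also have "\<dots> \<le> Hinf_norm av f" unfolding P_def by (rule gauss_1_trunc_le[OF f(1)])
    finally show ?thesis using f0 by (simp add: R_def pos_le_divide_eq)
  qed
  \<comment> \<open>The limes inferior of the root counts.  Infinitely many truncations attain it, and given finitely many
    circles almost all truncations have at least that many roots on each of them.\<close>
  define d where "d \<rho> = (LEAST v. frequently (\<lambda>N. cnt N \<rho> \<le> v) sequentially)" for \<rho>
  have d_freq: "frequently (\<lambda>N. cnt N \<rho> \<le> d \<rho>) sequentially" if \<rho>: "0 < \<rho>" "\<rho> < 1" for \<rho>
  proof -
    obtain v where v: "R < (1 / \<rho>) ^ v" using real_arch_pow[of "1 / \<rho>" R] \<rho> by auto
    have "cnt N \<rho> \<le> v" for N
    proof (rule ccontr)
      assume "\<not> cnt N \<rho> \<le> v"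
      then have "(1 / \<rho>) ^ v \<le> (1 / \<rho>) ^ cnt N \<rho>" using \<rho> by (intro power_increasing) auto
      moreover have "(1 / \<rho>) ^ cnt N \<rho> \<le> R" using cnt_le[of "{\<rho>}" N] \<rho> by simp
      ultimately show False using v by linarith
    qed
    then have "frequently (\<lambda>N. cnt N \<rho> \<le> v) sequentially" by simp
    then show ?thesis unfolding d_def by (rule LeastI)
  qed
  have d_ev: "eventually (\<lambda>N. d \<rho> \<le> cnt N \<rho>) sequentially" for \<rho>
  proof (cases "d \<rho>")
    case (Suc v)
    then have "\<not> frequently (\<lambda>N. cnt N \<rho> \<le> v) sequentially"
      using not_less_Least[of v "\<lambda>v. frequently (\<lambda>N. cnt N \<rho> \<le> v) sequentially"]
      by (simp add: d_def)
    then have "eventually (\<lambda>N. \<not> cnt N \<rho> \<le> v) sequentially" by (simp add: not_frequently)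
    then show ?thesis by eventually_elim (simp add: Suc)
  qed simp
  define M where "M \<rho> = (1 / \<rho>) ^ d \<rho>" for \<rho> :: real
  have sum_M: "(\<Sum>\<rho>\<in>S. ln (M \<rho>)) \<le> ln R" if S: "finite S" "S \<subseteq> {0<..<1}" for S
  proof -
    have "eventually (\<lambda>N. \<forall>\<rho>\<in>S. d \<rho> \<le> cnt N \<rho>) sequentially"
      using S(1) d_ev by (intro eventually_ball_finite) auto
    then obtain N where N: "\<And>\<rho>. \<rho> \<in> S \<Longrightarrow> d \<rho> \<le> cnt N \<rho>" by (auto simp: eventually_sequentially)
    have Mpos: "0 < M \<rho>" if "\<rho> \<in> S" for \<rho> using S(2) that by (auto simp: M_def)
    have "(\<Prod>\<rho>\<in>S. M \<rho>) \<le> (\<Prod>\<rho>\<in>S. (1 / \<rho>) ^ cnt N \<rho>)"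
      unfolding M_def using S(2) N by (intro prod_mono conjI power_increasing) force+
    also have "\<dots> \<le> R" by (rule cnt_le[OF S])
    finally have le: "(\<Prod>\<rho>\<in>S. M \<rho>) \<le> R" .
    have "0 < (\<Prod>\<rho>\<in>S. M \<rho>)" using Mpos by (intro prod_pos) auto
    then have "ln (\<Prod>\<rho>\<in>S. M \<rho>) \<le> ln R" using le by (intro ln_mono)
    moreover have "ln (\<Prod>\<rho>\<in>S. M \<rho>) = (\<Sum>\<rho>\<in>S. ln (M \<rho>))"
      using S(1) Mpos by (intro ln_prod) force+
    ultimately show ?thesis by simp
  qed
  \<comment> \<open>Two intermediate bounds: \<open>\<eta>1\<close> leaves room for the error of the truncation, and \<open>\<eta>2\<close> is a lower bound
    for the norm of \<open>f\<close> on all circles near the boundary.\<close>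
  obtain \<eta>1 where \<eta>1: "\<eta> < \<eta>1" "\<eta>1 < Hinf_norm av f" using dense[OF \<eta>(2)] by blast
  obtain \<eta>2 where \<eta>2: "\<eta>1 < \<eta>2" "\<eta>2 < Hinf_norm av f" using dense[OF \<eta>1(2)] by blast
  obtain k where k: "\<eta>2 < av (fps_nth f k)"
    using Hinf_norm_leI[OF f(1), of \<eta>2] \<eta>2 by (meson not_le)
  have "((\<lambda>\<rho>. av (fps_nth f k) * \<rho> ^ k) \<longlongrightarrow> av (fps_nth f k) * 1 ^ k) (at_left (1::real))"
    by (intro tendsto_intros)
  then have "eventually (\<lambda>\<rho>. \<eta>2 < av (fps_nth f k) * \<rho> ^ k) (at_left (1::real))"
    using k by (intro order_tendstoD) auto
  moreover have "eventually (\<lambda>\<rho>. 0 < \<rho> \<and> \<rho> < 1) (at_left (1::real))"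
    using eventually_at_left_real[of 0 1] by simp
  ultimately have "eventually (\<lambda>\<rho>. \<eta>2 < av (fps_nth f k) * \<rho> ^ k \<and> 0 < \<rho> \<and> \<rho> < 1) (at_left (1::real))"
    by eventually_elim simp
  then have "\<exists>\<rho>. \<eta>2 < av (fps_nth f k) * \<rho> ^ k \<and> 0 < \<rho> \<and> \<rho> < 1"
    by (rule eventually_happens'[OF trivial_limit_at_left_real])
  then obtain \<rho>0 where \<rho>0: "\<eta>2 < av (fps_nth f k) * \<rho>0 ^ k" "0 < \<rho>0" "\<rho>0 < 1" by blast
  have lower: "\<eta>2 < av (fps_nth f k) * \<rho> ^ k" if "\<rho>0 \<le> \<rho>" for \<rho>
  proof -
    have "av (fps_nth f k) * \<rho>0 ^ k \<le> av (fps_nth f k) * \<rho> ^ k"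
      using that \<rho>0 by (intro mult_left_mono power_mono av_nonneg) auto
    then show ?thesis using \<rho>0 by linarith
  qed
  have "\<exists>N. cnt N \<rho> \<le> d \<rho> \<and> k \<le> N \<and> Hinf_norm av f * \<rho> ^ Suc N < \<eta>1 - \<eta>" if \<rho>: "\<rho>0 \<le> \<rho>" "\<rho> < 1" for \<rho>
  proof -
    have "(\<lambda>N. Hinf_norm av f * \<rho> ^ Suc N) \<longlonglongrightarrow> 0"
      using \<rho> \<rho>0 by (intro tendsto_mult_right_zero LIMSEQ_Suc LIMSEQ_realpow_zero) auto
    then have "eventually (\<lambda>N. Hinf_norm av f * \<rho> ^ Suc N < \<eta>1 - \<eta>) sequentially"
      using \<eta>1 by (intro order_tendstoD) auto
    then have ev: "eventually (\<lambda>N. k \<le> N \<and> Hinf_norm av f * \<rho> ^ Suc N < \<eta>1 - \<eta>) sequentially"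
      using eventually_ge_at_top[of k] by eventually_elim simp
    have "frequently (\<lambda>N. cnt N \<rho> \<le> d \<rho> \<and> k \<le> N \<and> Hinf_norm av f * \<rho> ^ Suc N < \<eta>1 - \<eta>) sequentially"
      using d_freq[of \<rho>] ev \<rho> \<rho>0 by (auto intro: frequently_eventually_frequently)
    then show ?thesis by (rule frequently_ex)
  qed
  then obtain Nf where Nf: "\<And>\<rho>. \<lbrakk>\<rho>0 \<le> \<rho>; \<rho> < 1\<rbrakk> \<Longrightarrow> cnt (Nf \<rho>) \<rho> \<le> d \<rho>"
    "\<And>\<rho>. \<lbrakk>\<rho>0 \<le> \<rho>; \<rho> < 1\<rbrakk> \<Longrightarrow> k \<le> Nf \<rho>"
    "\<And>\<rho>. \<lbrakk>\<rho>0 \<le> \<rho>; \<rho> < 1\<rbrakk> \<Longrightarrow> Hinf_norm av f * \<rho> ^ Suc (Nf \<rho>) < \<eta>1 - \<eta>"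
    by metis
  define Q where "Q \<rho> = unit_factors (filter_mset (\<lambda>w. av w = \<rho>) (W (Nf \<rho>)))" for \<rho>
  show ?thesis
  proof (rule that[of "\<eta>1 / \<eta>2" \<rho>0 Q M "ln R"])
    show "0 \<le> \<eta>1 / \<eta>2" "\<eta>1 / \<eta>2 < 1" using \<eta> \<eta>1 \<eta>2 by auto
    show "0 < \<rho>0" "\<rho>0 < 1" by fact+
    show "coeff (Q \<rho>) 0 = 1" for \<rho> by (simp add: Q_def coeff_unit_factors)
    show "1 \<le> M \<rho>" if "\<rho>0 \<le> \<rho>" "\<rho> < 1" for \<rho>
      using that \<rho>0 by (simp add: M_def one_le_power)
    show "(\<Sum>\<rho>\<in>S. ln (M \<rho>)) \<le> ln R" if "finite S" "S \<subseteq> {\<rho>0..<1}" for S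
      using that \<rho>0 by (intro sum_M) auto
    show "gauss 1 (Q \<rho>) \<le> M \<rho>" if \<rho>: "\<rho>0 \<le> \<rho>" "\<rho> < 1" for \<rho>
    proof -
      let ?V = "filter_mset (\<lambda>w. av w = \<rho>) (W (Nf \<rho>))"
      have "gauss 1 (Q \<rho>) = (\<Prod>w\<in>#?V. max (av (0 - w)) 1 / av w)"
        unfolding Q_def disc_norm_0_centre[symmetric] using W0 by (intro disc_norm_unit_factors) auto
      also have "\<dots> = (\<Prod>w\<in>#?V. 1 / \<rho>)"
        using \<rho> by (intro arg_cong[of _ _ prod_mset] image_mset_cong) auto
      also have "\<dots> = (1 / \<rho>) ^ cnt (Nf \<rho>) \<rho>" by (simp add: cnt_def)
      also have "\<dots> \<le> M \<rho>" unfolding M_def using Nf(1)[OF \<rho>] \<rho> \<rho>0 by (intro power_increasing) auto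
      finally show ?thesis .
    qed
    show "disc_norm a r (Q \<rho>) \<le> \<eta>1 / \<eta>2"
      if \<rho>: "\<rho>0 \<le> \<rho>" "\<rho> < 1" and a: "av a = \<rho>" and r: "0 \<le> r" "r < 1" and le: "zeta a r f \<le> \<eta>" for \<rho> a r
    proof -
      \<comment> \<open>On a disc containing the circle \<open>f\<close> would be too large; this bounds the radius away from \<open>1\<close>, which
        the approximation by truncations requires.\<close>
      have "r < \<rho>"
      proof (rule ccontr)
        assume "\<not> r < \<rho>"
        then have "zeta a \<rho> f \<le> zeta a r f" using f a \<rho> \<rho>0 r by (intro zeta_mono) auto
        moreover have "av (fps_nth f k) * \<rho> ^ k \<le> zeta a \<rho> f"
          using f a \<rho> \<rho>0 by (intro zeta_ge_coeff) auto
        ultimately show False using lower[OF \<rho>(1)] le \<eta>1 \<eta>2 by linarith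
      qed
      then have "disc_norm a r (P (Nf \<rho>)) \<le> \<eta>1"
        using zeta_trunc_close[OF f(1) r(1), of \<rho> a "Suc (Nf \<rho>)"] a \<rho> le Nf(3)[OF \<rho>]
        unfolding P_def by simp
      moreover have "\<eta>2 \<le> gauss \<rho> (P (Nf \<rho>))"
        using gauss_ge[of \<rho> "P (Nf \<rho>)" k] lower[OF \<rho>(1)] Nf(2)[OF \<rho>] \<rho> \<rho>0
        by (simp add: P_def coeff_trunc less_Suc_eq_le)
      moreover have "gauss \<rho> (P (Nf \<rho>)) * disc_norm a r (Q \<rho>) \<le> disc_norm a r (P (Nf \<rho>))"
        unfolding Q_def using W0 a \<rho> \<rho>0 r W by (intro disc_norm_ge_unit_factors) auto
      moreover have "0 \<le> disc_norm a r (Q \<rho>)" using r by (intro disc_norm_nonneg)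
      ultimately have "\<eta>2 * disc_norm a r (Q \<rho>) \<le> \<eta>1"
        by (meson mult_right_mono order_trans)
      then show ?thesis using \<eta> \<eta>1 \<eta>2 by (simp add: pos_le_divide_eq mult.commute)
    qed
  qed
qed

text \<open>Since \<open>\<Sum>\<rho>. ln (M \<rho>)\<close> is finite over all circles that carry a point \<open>z n\<close>, the factors \<open>Q \<rho>\<close> may be
  raised to powers that tend to infinity.  By \<open>ex_circle_factors\<close> such a power is small on each disc
  about \<open>z n\<close> where \<open>f\<close> is at most \<open>\<eta>\<close>, and the other factors are bounded.\<close>

lemma ex_decaying_function:
  fixes z :: "nat \<Rightarrow> 'a"
  assumes f: "f \<in> Hinf av" "fps_nth f 0 \<noteq> 0" and \<eta>: "0 \<le> \<eta>" "\<eta> < Hinf_norm av f"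
    and D: "\<And>n. n \<in> D \<Longrightarrow> av (z n) < 1"
    and fin: "\<And>\<rho>. \<rho> < 1 \<Longrightarrow> finite {n \<in> D. av (z n) \<le> \<rho>}"
  obtains g where "g \<in> Hinf av" "g \<noteq> 0"
    "\<And>\<epsilon>. 0 < \<epsilon> \<Longrightarrow> \<exists>n0. \<forall>n\<in>D. n0 \<le> n \<longrightarrow>
      (\<forall>r. 0 \<le> r \<longrightarrow> r < 1 \<longrightarrow> zeta (z n) r f \<le> \<eta> \<longrightarrow> zeta (z n) r g \<le> \<epsilon>)"
proof -
  obtain Q M K \<rho>0 q where q: "0 \<le> q" "q < 1" and \<rho>0: "0 < \<rho>0" "\<rho>0 < 1"
    and Q0: "\<And>\<rho>. coeff (Q \<rho>) 0 = 1"
    and QM: "\<And>\<rho>. \<lbrakk>\<rho>0 \<le> \<rho>; \<rho> < 1\<rbrakk> \<Longrightarrow> gauss 1 (Q \<rho>) \<le> M \<rho>"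
    and M1: "\<And>\<rho>. \<lbrakk>\<rho>0 \<le> \<rho>; \<rho> < 1\<rbrakk> \<Longrightarrow> 1 \<le> M \<rho>"
    and MK: "\<And>S. \<lbrakk>finite S; S \<subseteq> {\<rho>0..<1}\<rbrakk> \<Longrightarrow> (\<Sum>\<rho>\<in>S. ln (M \<rho>)) \<le> K"
    and Qq: "\<And>\<rho> a r. \<lbrakk>\<rho>0 \<le> \<rho>; \<rho> < 1; av a = \<rho>; 0 \<le> r; r < 1; zeta a r f \<le> \<eta>\<rbrakk>
      \<Longrightarrow> disc_norm a r (Q \<rho>) \<le> q"
    by (rule ex_circle_factors[OF f \<eta>], rule that) assumption+
  \<comment> \<open>Several \<open>z n\<close> may lie on one circle, but each circle contributes one factor.\<close>
  define first where "first n \<longleftrightarrow> n \<in> D \<and> \<rho>0 \<le> av (z n) \<and> (\<forall>k<n. k \<in> D \<longrightarrow> av (z k) \<noteq> av (z n))" for n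
  have firstD: "\<rho>0 \<le> av (z n)" "av (z n) < 1" if "first n" for n
    using that D by (auto simp: first_def)
  define x where "x n = (if first n then ln (M (av (z n))) else 0)" for n
  have x: "0 \<le> x n" for n using M1 firstD[of n] by (simp add: x_def)
  have "summable x"
  proof (rule summableI_nonneg_bounded)
    fix J
    have inj: "inj_on (\<lambda>n. av (z n)) {n\<in>{..<J}. first n}"
      by (rule linorder_inj_onI) (auto simp: first_def)
    have "(\<Sum>n<J. x n) = (\<Sum>n\<in>{n\<in>{..<J}. first n}. ln (M (av (z n))))"
      unfolding x_def by (rule sum.inter_filter[symmetric]) simp
    also have "\<dots> = (\<Sum>\<rho>\<in>(\<lambda>n. av (z n)) ` {n\<in>{..<J}. first n}. ln (M \<rho>))"
      by (simp only: sum.reindex[OF inj] o_def)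
    also have "\<dots> \<le> K" using firstD by (intro MK) auto
    finally show "(\<Sum>n<J. x n) \<le> K" .
  qed (rule x)
  then obtain m :: "nat \<Rightarrow> nat" where m: "filterlim m at_top sequentially"
    and sum_m: "summable (\<lambda>n. real (m n)^2 * x n)"
    using summable_slow_weights[of x] x by blast
  define P where "P n = (if first n then Q (av (z n)) else 1)" for n
  define F where "F n = flat_power (m n) (P n)" for n
  have P: "gauss 1 (P n) \<le> exp (x n)" for n
  proof (cases "first n")
    case True
    have "1 \<le> M (av (z n))" using True by (intro M1 firstD)
    then show ?thesis using True QM firstD[of n] by (simp add: P_def x_def)
  qed (simp add: P_def x_def flip: disc_norm_0_centre)
  have P0: "coeff (P n) 0 = 1" for n by (simp add: P_def Q0)
  have expm: "exp (x n) ^ (m n ^ 2) = exp (real (m n)^2 * x n)" for n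
    by (simp flip: exp_of_nat_mult)
  define E where "E = exp (\<Sum>n. real (m n)^2 * x n)"
  have F_le: "disc_norm a r (F n) \<le> exp (real (m n)^2 * x n)"
    if "0 \<le> r" "r \<le> 1" "av a \<le> 1" for a r n
    unfolding F_def expm[symmetric] using disc_norm_flat_power(2)[OF that P] x by simp
  have bound: "(\<Prod>n<J. gauss 1 (F n)) \<le> E" for J
    unfolding E_def using F_le[of 1 0] x sum_m
    by (intro prod_le_exp_suminf) (auto simp: gauss_nonneg disc_norm_0_centre)
  have Fcoeff: "coeff (F n) k = coeff 1 k" if "k < m n" for n k
    unfolding F_def using P0 that by (rule coeff_flat_power)
  obtain g where g: "g \<in> Hinf av"
    "\<And>k. eventually (\<lambda>J. coeff (\<Prod>n<J. F n) k = fps_nth g k) sequentially"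
    "\<And>a r. \<lbrakk>0 \<le> r; r < 1; av a < 1\<rbrakk> \<Longrightarrow> (\<lambda>J. \<Prod>n<J. disc_norm a r (F n)) \<longlonglongrightarrow> zeta a r g"
    using infinite_product[OF m Fcoeff bound] by metis
  have "g \<noteq> 0"
  proof -
    have "poly (P n) 0 = 1" for n using P0[of n] by (simp add: poly_0_coeff_0)
    then have "poly (F n) 0 = 1" for n
      by (cases "m n") (simp_all add: F_def flat_power_def)
    then have "coeff (\<Prod>n<J. F n) 0 = 1" for J
      by (simp add: poly_prod flip: poly_0_coeff_0)
    then have "fps_nth g 0 = 1" using g(2)[of 0] by (auto simp: eventually_sequentially)
    then show ?thesis by auto
  qed
  have main: "zeta (z n) r g \<le> q ^ m j * E"
    if n: "n \<in> D" and j: "first j" "av (z j) = av (z n)" and r: "0 \<le> r" "r < 1" "zeta (z n) r f \<le> \<eta>"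
    for n j r
  proof (rule LIMSEQ_le_const2[OF g(3)[OF r(1,2) D[OF n]]])
    have Fj: "disc_norm (z n) r (F j) \<le> q ^ m j * exp (real (m j)^2 * x j)"
    proof -
      have "disc_norm (z n) r (P j) \<le> q"
        unfolding P_def using firstD[OF j(1)] j r by (simp add: Qq)
      then have "disc_norm (z n) r (P j) ^ m j \<le> q ^ m j"
        using r by (intro power_mono disc_norm_nonneg)
      then have "disc_norm (z n) r (P j) ^ m j * exp (x j) ^ (m j ^ 2) \<le> q ^ m j * exp (x j) ^ (m j ^ 2)"
        by (intro mult_right_mono) auto
      moreover have "disc_norm (z n) r (F j) \<le> disc_norm (z n) r (P j) ^ m j * exp (x j) ^ (m j ^ 2)"
        unfolding F_def using r D[OF n] P x by (intro disc_norm_flat_power(1)) auto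
      ultimately show ?thesis unfolding expm by linarith
    qed
    have "(\<Prod>k<J. disc_norm (z n) r (F k)) \<le> q ^ m j * E" if "Suc j \<le> J" for J
    proof -
      have "(\<Prod>k<J. disc_norm (z n) r (F k)) = disc_norm (z n) r (F j) * (\<Prod>k\<in>{..<J}-{j}. disc_norm (z n) r (F k))"
        using that by (intro prod.remove) auto
      also have "\<dots> \<le> (q ^ m j * exp (real (m j)^2 * x j)) * (\<Prod>k\<in>{..<J}-{j}. exp (real (m k)^2 * x k))"
        using Fj F_le[of r "z n"] r D[OF n] q
        by (intro mult_mono prod_mono prod_nonneg) (auto simp: disc_norm_nonneg)
      also have "\<dots> = q ^ m j * (\<Prod>k<J. exp (real (m k)^2 * x k))"
        using that by (subst (2) prod.remove[of _ j]) auto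
      also have "\<dots> \<le> q ^ m j * E"
        unfolding E_def using q x sum_m by (intro mult_left_mono prod_le_exp_suminf) auto
      finally show ?thesis .
    qed
    then show "\<exists>N. \<forall>J\<ge>N. (\<Prod>k<J. disc_norm (z n) r (F k)) \<le> q ^ m j * E" by blast
  qed
  show ?thesis
  proof (rule that[OF g(1) \<open>g \<noteq> 0\<close>])
    fix \<epsilon> :: real assume \<epsilon>: "0 < \<epsilon>"
    have "(\<lambda>j. q ^ m j * E) \<longlonglongrightarrow> 0"
      using q m by (intro tendsto_mult_left_zero filterlim_compose[OF LIMSEQ_realpow_zero]) auto
    then have "eventually (\<lambda>j. q ^ m j * E < \<epsilon>) sequentially" using \<epsilon> by (intro order_tendstoD) auto
    then obtain J where J: "\<And>j. J \<le> j \<Longrightarrow> q ^ m j * E < \<epsilon>" by (auto simp: eventually_sequentially)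
    define \<rho>1 where "\<rho>1 = Max (insert \<rho>0 ((\<lambda>j. av (z j)) ` {j \<in> {..<J}. j \<in> D}))"
    have "\<rho>1 < 1" unfolding \<rho>1_def using \<rho>0 D by (subst Max_less_iff) auto
    have \<rho>1: "\<rho>0 \<le> \<rho>1" "\<And>j. \<lbrakk>j < J; j \<in> D\<rbrakk> \<Longrightarrow> av (z j) \<le> \<rho>1"
      unfolding \<rho>1_def by (auto intro: Max_ge)
    have "finite {n \<in> D. av (z n) \<le> \<rho>1}" by (rule fin[OF \<open>\<rho>1 < 1\<close>])
    then obtain n0 where n0: "\<And>n. \<lbrakk>n \<in> D; av (z n) \<le> \<rho>1\<rbrakk> \<Longrightarrow> n < n0"
      using finite_nat_set_iff_bounded by auto
    have "zeta (z n) r g \<le> \<epsilon>" if n: "n \<in> D" "n0 \<le> n" and r: "0 \<le> r" "r < 1" "zeta (z n) r f \<le> \<eta>" for n r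
    proof -
      have big: "\<rho>1 < av (z n)" using n0[OF n(1)] n(2) by linarith
      define j where "j = (LEAST j. j \<in> D \<and> av (z j) = av (z n))"
      have j: "j \<in> D \<and> av (z j) = av (z n)"
        unfolding j_def by (rule LeastI[of _ n]) (use n in auto)
      have "first j"
        unfolding first_def using j big \<rho>1(1) not_less_Least[of _ "\<lambda>j. j \<in> D \<and> av (z j) = av (z n)"]
        by (auto simp flip: j_def)
      then have "zeta (z n) r g \<le> q ^ m j * E" using n j r by (intro main) auto
      moreover have "J \<le> j" using \<rho>1(2)[of j] j big by (cases "j < J") auto
      ultimately show ?thesis using J[of j] by linarith
    qed
    then show "\<exists>n0. \<forall>n\<in>D. n0 \<le> n \<longrightarrow>
      (\<forall>r. 0 \<le> r \<longrightarrow> r < 1 \<longrightarrow> zeta (z n) r f \<le> \<eta> \<longrightarrow> zeta (z n) r g \<le> \<epsilon>)" by blast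
  qed
qed


section \<open>Kernels of seminorms\<close>

lemma ring_Hinf: "ring (Hinf_ring av)"
proof (rule ringI)
  show "abelian_group (Hinf_ring av)"
    by (rule abelian_groupI)
      (auto simp: Hinf_ring_def Hinf_add Hinf_0 algebra_simps intro: bexI[of _ "- x" for x] Hinf_uminus)
  show "Group.monoid (Hinf_ring av)"
    by (rule monoidI) (auto simp: Hinf_ring_def Hinf_mult Hinf_1 algebra_simps)
qed (auto simp: Hinf_ring_def algebra_simps)

lemma ideal_seminorm_ker:
  assumes \<phi>: "\<phi> \<in> Berkovich av" shows "ideal (seminorm_ker av \<phi>) (Hinf_ring av)"
proof (rule idealI[OF ring_Hinf])
  interpret R: ring "Hinf_ring av" by (rule ring_Hinf)
  have uminus: "\<ominus>\<^bsub>Hinf_ring av\<^esub> f = - f" if "f \<in> Hinf av" for f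
    using that Hinf_uminus[OF that] by (intro R.minus_equality) (auto simp: Hinf_ring_def)
  have ker_uminus: "- f \<in> seminorm_ker av \<phi>" if "f \<in> seminorm_ker av \<phi>" for f
    using that Berkovich_mult[OF \<phi> Hinf_uminus[OF Hinf_1], of f] Hinf_uminus[of f]
    by (simp add: seminorm_ker_def)
  show "subgroup (seminorm_ker av \<phi>) (add_monoid (Hinf_ring av))"
  proof (rule subgroup.intro)
    show "seminorm_ker av \<phi> \<subseteq> carrier (add_monoid (Hinf_ring av))"
      by (auto simp: seminorm_ker_def Hinf_ring_def)
    fix f g assume fg: "f \<in> seminorm_ker av \<phi>" "g \<in> seminorm_ker av \<phi>"
    then have H: "f \<in> Hinf av" "g \<in> Hinf av" "\<phi> f = 0" "\<phi> g = 0" by (auto simp: seminorm_ker_def)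
    then have "\<phi> (f + g) = 0"
      using Berkovich_add_le[OF \<phi> H(1,2)] Berkovich_nonneg[OF \<phi> Hinf_add[OF H(1,2)]] by simp
    then show "f \<otimes>\<^bsub>add_monoid (Hinf_ring av)\<^esub> g \<in> seminorm_ker av \<phi>"
      using H by (simp add: seminorm_ker_def Hinf_ring_def Hinf_add)
  next
    show "\<one>\<^bsub>add_monoid (Hinf_ring av)\<^esub> \<in> seminorm_ker av \<phi>"
      using Berkovich_0[OF \<phi>] by (simp add: seminorm_ker_def Hinf_ring_def Hinf_0)
    fix f assume f: "f \<in> seminorm_ker av \<phi>"
    then have "f \<in> Hinf av" by (simp add: seminorm_ker_def)
    then show "inv\<^bsub>add_monoid (Hinf_ring av)\<^esub> f \<in> seminorm_ker av \<phi>"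
      using uminus[of f] ker_uminus[OF f] by (simp add: a_inv_def)
  qed
qed (use Berkovich_mult[OF \<phi>] in \<open>auto simp: seminorm_ker_def Hinf_ring_def Hinf_mult\<close>)

text \<open>The kernel of \<open>\<psi>\<close> lies strictly between that of \<open>\<phi>\<close> and the whole algebra.\<close>

lemma not_maximalideal_seminorm_ker:
  assumes \<phi>: "\<phi> \<in> Berkovich av" and \<psi>: "\<psi> \<in> Berkovich av" and le: "\<psi> \<le> \<phi>"
    and B: "B \<in> Hinf av" "\<psi> B = 0" "\<phi> B \<noteq> 0"
  shows "\<not> maximalideal (seminorm_ker av \<phi>) (Hinf_ring av)"
proof
  assume max: "maximalideal (seminorm_ker av \<phi>) (Hinf_ring av)"
  have sub: "seminorm_ker av \<phi> \<subseteq> seminorm_ker av \<psi>"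
  proof
    fix f assume "f \<in> seminorm_ker av \<phi>"
    then have f: "f \<in> Hinf av" "\<phi> f = 0" by (auto simp: seminorm_ker_def)
    then have "\<psi> f \<le> 0" using le by (auto dest: le_funD[of _ _ f])
    then show "f \<in> seminorm_ker av \<psi>"
      using f Berkovich_nonneg[OF \<psi> f(1)] by (simp add: seminorm_ker_def)
  qed
  have "seminorm_ker av \<psi> = seminorm_ker av \<phi> \<or> seminorm_ker av \<psi> = carrier (Hinf_ring av)"
    by (rule maximalideal.I_maximal[OF max ideal_seminorm_ker[OF \<psi>] sub])
      (auto simp: seminorm_ker_def Hinf_ring_def)
  moreover have "B \<in> seminorm_ker av \<psi>" "B \<notin> seminorm_ker av \<phi>"
    using B by (auto simp: seminorm_ker_def)
  moreover have "1 \<in> carrier (Hinf_ring av)" "1 \<notin> seminorm_ker av \<psi>"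
    using Berkovich_1[OF \<psi>] Hinf_1 by (auto simp: seminorm_ker_def Hinf_ring_def)
  ultimately show False by blast
qed

end


section \<open>The chain\<close>

locale regular_ultra_sequence = alg_closed_nonarch_field av
  for av :: "'a::alg_closed_field \<Rightarrow> real" +
  fixes z :: "nat \<Rightarrow> 'a" and U :: "nat filter"
  assumes z: "\<And>n. av (z n) < 1"
    and U: "nonprincipal_ultrafilter U"
    and regular: "regular_seq av z U"
begin

definition chain :: "('a fps \<Rightarrow> real) set" where
  "chain = ultralimit U (Berkovich_topology av) (\<lambda>n. zeta (z n) ` {0..<1})"

abbreviation bottom :: "'a fps \<Rightarrow> real" where
  "bottom \<equiv> delta_ultra av z U"

lemma chain_in_Berkovich: "\<phi> \<in> chain \<Longrightarrow> \<phi> \<in> Berkovich av"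
  by (simp add: chain_def ultralimit_def)

lemma compactin_chain: "compactin (Berkovich_topology av) chain"
  unfolding chain_def by (intro compactin_ultralimit compact_Berkovich)

lemma connectedin_chain: "connectedin (Berkovich_topology av) chain"
  unfolding chain_def using z
  by (intro connectedin_ultralimit U compact_Berkovich Hausdorff_Berkovich always_eventually allI
      connectedin_zeta_path)

lemma bottom_tendsto: "f \<in> Hinf av \<Longrightarrow> ((\<lambda>n. zeta (z n) 0 f) \<longlongrightarrow> bottom f) U"
  using delta_ultra_limit[of U z, OF U z]
  unfolding Berkovich_topology_def limitin_subtopology limitin_componentwise by simp

lemma bottom_in_chain: "bottom \<in> chain"
  unfolding chain_def ultralimit_def
proof (intro CollectI conjI allI impI)
  note lim = delta_ultra_limit[of U z, OF U z]
  show "bottom \<in> topspace (Berkovich_topology av)" using lim by (rule limitin_topspace)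
  fix N assume "openin (Berkovich_topology av) N \<and> bottom \<in> N"
  then have "eventually (\<lambda>n. zeta (z n) 0 \<in> N) U" using lim by (simp add: limitin_def)
  then show "eventually (\<lambda>n. zeta (z n) ` {0..<1} \<inter> N \<noteq> {}) U"
    by eventually_elim force
qed

lemma norm_in_chain: "Hinf_norm av \<in> chain"
  unfolding chain_def ultralimit_def
proof (intro CollectI conjI allI impI always_eventually)
  show "Hinf_norm av \<in> topspace (Berkovich_topology av)" by (simp add: Hinf_norm_in_Berkovich)
  fix N n assume N: "openin (Berkovich_topology av) N \<and> Hinf_norm av \<in> N"
  have r: "eventually (\<lambda>r. 0 < r \<and> r < 1) (at_left (1::real))"
    using eventually_at_left_real[of 0 1] by simp
  have "eventually (\<lambda>r. zeta (z n) r \<in> Berkovich av) (at_left 1)"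
    using r by eventually_elim (use z in \<open>auto intro: zeta_in_Berkovich\<close>)
  then have "limitin (Berkovich_topology av) (zeta (z n)) (Hinf_norm av) (at_left 1)"
    using z by (intro limitin_Berkovich Hinf_norm_in_Berkovich zeta_tendsto_norm)
  then have "eventually (\<lambda>r. zeta (z n) r \<in> N) (at_left 1)" using N by (simp add: limitin_def)
  with r have "eventually (\<lambda>r. 0 < r \<and> r < 1 \<and> zeta (z n) r \<in> N) (at_left 1)"
    by eventually_elim simp
  then have "\<exists>r. 0 < r \<and> r < 1 \<and> zeta (z n) r \<in> N"
    by (rule eventually_happens'[OF trivial_limit_at_left_real])
  then obtain r where "0 < r" "r < 1" "zeta (z n) r \<in> N" by blast
  then have "zeta (z n) r \<in> zeta (z n) ` {0..<1} \<inter> N" by auto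
  then show "zeta (z n) ` {0..<1} \<inter> N \<noteq> {}" by blast
qed

text \<open>Two functions at a time suffice to compare elements of the chain and to compute their kernels.\<close>

lemma chain_approx:
  assumes \<phi>: "\<phi> \<in> chain" and f: "f \<in> Hinf av" and g: "g \<in> Hinf av" and e: "0 < e"
  shows "eventually (\<lambda>n. \<exists>r. 0 \<le> r \<and> r < 1 \<and> \<bar>zeta (z n) r f - \<phi> f\<bar> < e \<and>
    \<bar>zeta (z n) r g - \<phi> g\<bar> < e) U"
proof -
  define N where "N h = {\<theta> \<in> topspace (Berkovich_topology av). \<theta> h \<in> ball (\<phi> h) e}" for h
  have "openin (Berkovich_topology av) (N h)" if "h \<in> Hinf av" for h
    unfolding N_def
    by (rule openin_continuous_map_preimage[OF continuous_map_Berkovich_eval[OF that]]) simp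
  then have "openin (Berkovich_topology av) (N f \<inter> N g)" using f g by blast
  moreover have "\<phi> \<in> N f \<inter> N g" using chain_in_Berkovich[OF \<phi>] e by (simp add: N_def)
  ultimately have "eventually (\<lambda>n. zeta (z n) ` {0..<1} \<inter> (N f \<inter> N g) \<noteq> {}) U"
    using \<phi> unfolding chain_def ultralimit_def by simp
  then show ?thesis
  proof eventually_elim
    case (elim n)
    then obtain r where "0 \<le> r" "r < 1" "zeta (z n) r \<in> N f" "zeta (z n) r \<in> N g" by auto
    then show ?case by (intro exI[of _ r]) (auto simp: N_def dist_real_def abs_minus_commute)
  qed
qed

lemma eventually_U_False: "eventually (\<lambda>n. False) U \<Longrightarrow> P"
  using nonprincipal_ultrafilterD(1)[OF U] by (simp add: trivial_limit_def)

text \<open>Two elements of the chain are approximated on the same path \<open>r \<mapsto> zeta (z n) r\<close>, which is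
  monotone.\<close>

lemma chain_linear:
  assumes \<phi>: "\<phi> \<in> chain" and \<psi>: "\<psi> \<in> chain" shows "\<phi> \<le> \<psi> \<or> \<psi> \<le> \<phi>"
proof (rule ccontr)
  assume not: "\<not> (\<phi> \<le> \<psi> \<or> \<psi> \<le> \<phi>)"
  note ext = Berkovich_ext[OF chain_in_Berkovich]
  obtain f where f: "f \<in> Hinf av" "\<psi> f < \<phi> f"
    using not extensional_leI[OF ext[OF \<phi>] ext[OF \<psi>]] by (meson not_le)
  obtain g where g: "g \<in> Hinf av" "\<phi> g < \<psi> g"
    using not extensional_leI[OF ext[OF \<psi>] ext[OF \<phi>]] by (meson not_le)
  define e where "e = min (\<phi> f - \<psi> f) (\<psi> g - \<phi> g) / 2"
  have e: "0 < e" "2 * e \<le> \<phi> f - \<psi> f" "2 * e \<le> \<psi> g - \<phi> g" using f g by (auto simp: e_def)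
  from chain_approx[OF \<phi> f(1) g(1) e(1)] chain_approx[OF \<psi> f(1) g(1) e(1)]
  have "eventually (\<lambda>n. False) U"
  proof eventually_elim
    case (elim n)
    then obtain r s where r: "0 \<le> r" "r < 1" "\<bar>zeta (z n) r f - \<phi> f\<bar> < e" "\<bar>zeta (z n) r g - \<phi> g\<bar> < e"
      and s: "0 \<le> s" "s < 1" "\<bar>zeta (z n) s f - \<psi> f\<bar> < e" "\<bar>zeta (z n) s g - \<psi> g\<bar> < e" by blast
    show ?case
    proof (cases "r \<le> s")
      case True
      have "zeta (z n) r f \<le> zeta (z n) s f" using f r s True z by (intro zeta_mono) auto
      then show ?thesis using r(3) s(3) e by linarith
    next
      case False
      have "zeta (z n) s g \<le> zeta (z n) r g" using g r s False z by (intro zeta_mono) auto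
      then show ?thesis using r(4) s(4) e by linarith
    qed
  qed
  then show False by (rule eventually_U_False)
qed

lemma bottom_le:
  assumes \<phi>: "\<phi> \<in> chain" shows "bottom \<le> \<phi>"
proof (rule extensional_leI)
  show "bottom \<in> extensional (Hinf av)" "\<phi> \<in> extensional (Hinf av)"
    using bottom_in_chain \<phi> by (auto intro: Berkovich_ext chain_in_Berkovich)
  fix f assume f: "f \<in> Hinf av"
  show "bottom f \<le> \<phi> f"
  proof (rule ccontr)
    assume less: "\<not> bottom f \<le> \<phi> f"
    define e where "e = (bottom f - \<phi> f) / 2"
    have e: "0 < e" "\<phi> f + e = bottom f - e" using less by (auto simp: e_def field_simps)
    have "eventually (\<lambda>n. bottom f - e < zeta (z n) 0 f) U"
      using e by (intro order_tendstoD[OF bottom_tendsto[OF f]]) auto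
    with chain_approx[OF \<phi> f f e(1)] have "eventually (\<lambda>n. False) U"
    proof eventually_elim
      case (elim n)
      then obtain r where r: "0 \<le> r" "r < 1" "\<bar>zeta (z n) r f - \<phi> f\<bar> < e" by blast
      have "zeta (z n) 0 f \<le> zeta (z n) r f" using f r z by (intro zeta_mono) auto
      then show ?case using r elim(2) e(2) by linarith
    qed
    then show False by (rule eventually_U_False)
  qed
qed

lemma le_norm: "\<phi> \<in> chain \<Longrightarrow> \<phi> \<le> Hinf_norm av"
  by (rule extensional_leI[of _ "Hinf av"])
    (auto intro: Berkovich_ext Berkovich_le_norm chain_in_Berkovich norm_in_chain)

lemma seminorm_ker_nontrivial:
  assumes \<phi>: "\<phi> \<in> chain" and ne: "\<phi> \<noteq> Hinf_norm av" shows "seminorm_ker av \<phi> \<noteq> {0}"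
proof -
  note \<phi>B = chain_in_Berkovich[OF \<phi>]
  obtain D \<delta> where D: "eventually (\<lambda>n. n \<in> D) U" "\<And>n. n \<in> D \<Longrightarrow> 0 < av (z n)"
    and sum: "summable (\<lambda>n. if n \<in> D then ln (1 / av (z n)) else 0)"
    using regular_seqE[OF U z regular] by metis
  have "\<not> Hinf_norm av \<le> \<phi>" using ne le_norm[OF \<phi>] by auto
  then obtain f' where f': "f' \<in> Hinf av" "\<phi> f' < Hinf_norm av f'"
    using extensional_leI[OF Berkovich_ext[OF Hinf_norm_in_Berkovich] Berkovich_ext[OF \<phi>B]]
    by (meson not_le)
  \<comment> \<open>A zero at the origin is removed by adding a small constant.\<close>
  obtain f where f: "f \<in> Hinf av" "\<phi> f < Hinf_norm av f" "fps_nth f 0 \<noteq> 0"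
  proof (cases "fps_nth f' 0 = 0")
    case True
    obtain c where c: "c \<noteq> 0" "av c < (Hinf_norm av f' - \<phi> f') / 2"
      using ex_small_av[of "(Hinf_norm av f' - \<phi> f') / 2"] f' by auto
    have cH: "fps_const c \<in> Hinf av" "fps_const (- c) \<in> Hinf av" by (rule Hinf_const)+
    have const: "Hinf_norm av (fps_const b) \<le> av b" for b
      by (rule Hinf_norm_leI[OF Hinf_const]) (simp add: av_nonneg)
    have "\<phi> (f' + fps_const c) \<le> \<phi> f' + av c"
      using Berkovich_add_le[OF \<phi>B f'(1) cH(1)] Berkovich_le_norm[OF \<phi>B cH(1)] const[of c] by linarith
    moreover have "Hinf_norm av f' \<le> Hinf_norm av (f' + fps_const c) + av c"
    proof -
      have eq: "(f' + fps_const c) + fps_const (- c) = f'" by (simp flip: fps_const_neg)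
      have "Hinf_norm av f' \<le> Hinf_norm av (f' + fps_const c) + Hinf_norm av (fps_const (- c))"
        using Berkovich_add_le[OF Hinf_norm_in_Berkovich Hinf_add[OF f'(1) cH(1)] cH(2)]
        unfolding eq .
      then show ?thesis using const[of "- c"] by simp
    qed
    ultimately have "\<phi> (f' + fps_const c) < Hinf_norm av (f' + fps_const c)"
      using c(2) by (simp add: field_simps)
    then show ?thesis using True c(1) Hinf_add[OF f'(1) cH(1)] by (intro that[of "f' + fps_const c"]) auto
  qed (use f' that in blast)
  obtain \<eta> where \<eta>: "\<phi> f < \<eta>" "\<eta> < Hinf_norm av f" using dense[OF f(2)] by blast
  have \<eta>0: "0 \<le> \<eta>" using Berkovich_nonneg[OF \<phi>B f(1)] \<eta>(1) by linarith
  obtain g where g: "g \<in> Hinf av" "g \<noteq> 0"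
    and dec: "\<And>\<epsilon>. 0 < \<epsilon> \<Longrightarrow> \<exists>n0. \<forall>n\<in>D. n0 \<le> n \<longrightarrow>
      (\<forall>r. 0 \<le> r \<longrightarrow> r < 1 \<longrightarrow> zeta (z n) r f \<le> \<eta> \<longrightarrow> zeta (z n) r g \<le> \<epsilon>)"
    by (rule ex_decaying_function[OF f(1,3) \<eta>0 \<eta>(2) z finite_inside_disc[OF sum D(2)]], assumption+, rule that)
  have "\<phi> g \<le> 0 + \<epsilon>" if \<epsilon>: "0 < \<epsilon>" for \<epsilon>
  proof (rule ccontr)
    assume less: "\<not> \<phi> g \<le> 0 + \<epsilon>"
    define e where "e = min (\<eta> - \<phi> f) (\<epsilon> / 2)"
    have e: "0 < e" "\<phi> f + e \<le> \<eta>" "e \<le> \<epsilon> / 2" using \<eta> \<epsilon> unfolding e_def by linarith+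
    obtain n0 where n0: "\<And>n r. \<lbrakk>n \<in> D; n0 \<le> n; 0 \<le> r; r < 1; zeta (z n) r f \<le> \<eta>\<rbrakk>
        \<Longrightarrow> zeta (z n) r g \<le> \<epsilon> / 2"
      using dec[of "\<epsilon> / 2"] \<epsilon> by auto
    have "eventually (\<lambda>n. n0 \<le> n) U"
      by (rule nonprincipal_ultrafilter_le_sequentially[OF U eventually_ge_at_top])
    with D(1) chain_approx[OF \<phi> f(1) g(1) e(1)] have "eventually (\<lambda>n. False) U"
    proof eventually_elim
      case (elim n)
      then obtain r where r: "0 \<le> r" "r < 1" "\<bar>zeta (z n) r f - \<phi> f\<bar> < e" "\<bar>zeta (z n) r g - \<phi> g\<bar> < e"
        by blast
      have "zeta (z n) r f \<le> \<eta>" using r(3) e(2) by linarith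
      then have "zeta (z n) r g \<le> \<epsilon> / 2" using elim r by (intro n0)
      then show ?case using r(4) e(3) less by linarith
    qed
    then show False by (rule eventually_U_False)
  qed
  then have "\<phi> g \<le> 0" by (rule field_le_epsilon)
  then have "g \<in> seminorm_ker av \<phi>"
    using g(1) Berkovich_nonneg[OF \<phi>B g(1)] by (simp add: seminorm_ker_def)
  then show ?thesis using g(2) by blast
qed

lemma seminorm_ker_not_maximal:
  assumes \<phi>: "\<phi> \<in> chain" and ne: "\<phi> \<noteq> bottom"
  shows "\<not> maximalideal (seminorm_ker av \<phi>) (Hinf_ring av)"
proof -
  note \<phi>B = chain_in_Berkovich[OF \<phi>]
  note bB = chain_in_Berkovich[OF bottom_in_chain]
  obtain D \<delta> where D: "eventually (\<lambda>n. n \<in> D) U" "\<And>n. n \<in> D \<Longrightarrow> 0 < av (z n)" "0 < \<delta>"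
    and sum: "summable (\<lambda>n. if n \<in> D then ln (1 / av (z n)) else 0)"
    and sep: "\<And>n J. \<lbrakk>n \<in> D; finite J; J \<subseteq> D - {n}\<rbrakk> \<Longrightarrow> \<delta> \<le> (\<Prod>k\<in>J. av (z n - z k))"
    by (rule regular_seqE[OF U z regular], rule that) assumption+
  obtain B where B: "B \<in> Hinf av" "\<And>n. n \<in> D \<Longrightarrow> zeta (z n) 0 B = 0"
    "\<And>n r \<delta>. \<lbrakk>n \<in> D; 0 \<le> r; r < 1; \<And>J. \<lbrakk>finite J; J \<subseteq> D - {n}\<rbrakk> \<Longrightarrow> \<delta> \<le> (\<Prod>k\<in>J. av (z n - z k))\<rbrakk>
      \<Longrightarrow> r * \<delta> \<le> zeta (z n) r B"
    using ex_vanishing_function[OF D(2) z sum] by metis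
  have "bottom B = 0"
  proof (rule tendsto_unique[OF nonprincipal_ultrafilterD(1)[OF U] bottom_tendsto[OF B(1)]])
    have "eventually (\<lambda>n. zeta (z n) 0 B = 0) U" using D(1) by eventually_elim (rule B(2))
    then show "((\<lambda>n. zeta (z n) 0 B) \<longlongrightarrow> 0) U" by (rule tendsto_eventually)
  qed
  moreover have "\<phi> B \<noteq> 0"
  proof
    assume \<phi>0: "\<phi> B = 0"
    have "\<not> \<phi> \<le> bottom" using ne bottom_le[OF \<phi>] by auto
    then obtain f where f: "f \<in> Hinf av" "bottom f < \<phi> f"
      using extensional_leI[OF Berkovich_ext[OF \<phi>B] Berkovich_ext[OF bB]] by (meson not_le)
    define C where "C = Hinf_norm av f"
    have C: "0 \<le> C" using f(1) by (simp add: C_def Hinf_norm_nonneg)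
    define e where "e = (\<phi> f - bottom f) / 3"
    have e: "0 < e" using f(2) by (simp add: e_def)
    \<comment> \<open>A bound for the radius below which \<open>f\<close> varies by at most \<open>e\<close> on the discs: on \<open>[0, 1/2]\<close> the Lipschitz
      constant is \<open>2 * C\<close>.\<close>
    define \<rho> where "\<rho> = min (1/2) (e / (2 * C + 1))"
    have \<rho>: "0 < \<rho>" using e C by (simp add: \<rho>_def)
    have \<rho>_le: "\<rho> \<le> 1/2" "\<rho> \<le> e / (2 * C + 1)"
      unfolding \<rho>_def by (rule min.cobounded1 min.cobounded2)+
    have \<rho>e: "2 * C * \<rho> \<le> e"
    proof -
      have "\<rho> * (2 * C + 1) \<le> e" using \<rho>_le(2) C by (simp add: pos_le_divide_eq)
      then show ?thesis using \<rho> by (simp add: algebra_simps)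
    qed
    define e' where "e' = min e (\<rho> * \<delta>)"
    have e': "0 < e'" "e' \<le> e" "e' \<le> \<rho> * \<delta>" using e \<rho> D(3) by (auto simp: e'_def)
    have "eventually (\<lambda>n. zeta (z n) 0 f < bottom f + e) U"
      using e by (intro order_tendstoD[OF bottom_tendsto[OF f(1)]]) auto
    with D(1) chain_approx[OF \<phi> f(1) B(1) e'(1)] have "eventually (\<lambda>n. False) U"
    proof eventually_elim
      case (elim n)
      then obtain r where r: "0 \<le> r" "r < 1" "\<bar>zeta (z n) r f - \<phi> f\<bar> < e'" "\<bar>zeta (z n) r B - \<phi> B\<bar> < e'"
        by blast
      have "r * \<delta> \<le> zeta (z n) r B" using elim(1) r sep by (intro B(3)) auto
      then have "r * \<delta> < \<rho> * \<delta>" using r(4) \<phi>0 e'(3) by linarith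
      then have "r < \<rho>" using D(3) by simp
      then have "zeta (z n) r f \<le> zeta (z n) 0 f + Hinf_norm av f / (1 - 1/2) * (r - 0)"
        using r z f(1) \<rho>_le by (intro zeta_Lipschitz) auto
      also have "Hinf_norm av f / (1 - 1/2) * (r - 0) = 2 * C * r" by (simp add: C_def)
      also have "2 * C * r \<le> 2 * C * \<rho>" using C \<open>r < \<rho>\<close> by (intro mult_left_mono) auto
      finally have "zeta (z n) r f \<le> zeta (z n) 0 f + e" using \<rho>e by linarith
      moreover have "\<phi> f = bottom f + 3 * e" by (simp add: e_def field_simps)
      ultimately show ?case using r(3) e'(2) elim(3) by linarith
    qed
    then show False by (rule eventually_U_False)
  qed
  ultimately show ?thesis
    using bottom_le[OF \<phi>] B(1) by (intro not_maximalideal_seminorm_ker[OF \<phi>B bB])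
qed

end

theorem theorem2p2:
  fixes av :: "'a::alg_closed_field \<Rightarrow> real"
    and z :: "nat \<Rightarrow> 'a"
    and U :: "nat filter"
  assumes "complete_nonarch_field av"
    and "\<And>n. z n \<in> unit_disc av"
    and "nonprincipal_ultrafilter U"
    and "regular_seq av z U"
  shows "\<exists>A \<subseteq> Berkovich av.
      compactin (Berkovich_topology av) A \<and>
      connectedin (Berkovich_topology av) A \<and>
      (\<forall>\<phi>\<in>A. \<forall>\<psi>\<in>A. \<phi> \<le> \<psi> \<or> \<psi> \<le> \<phi>) \<and>
      delta_ultra av z U \<in> A \<and> (\<forall>\<phi>\<in>A. delta_ultra av z U \<le> \<phi>) \<and>
      Hinf_norm av \<in> A \<and> (\<forall>\<phi>\<in>A. \<phi> \<le> Hinf_norm av) \<and>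
      (\<forall>\<phi> \<in> A - {delta_ultra av z U, Hinf_norm av}.
         ideal (seminorm_ker av \<phi>) (Hinf_ring av) \<and>
         seminorm_ker av \<phi> \<noteq> {0} \<and>
         \<not> maximalideal (seminorm_ker av \<phi>) (Hinf_ring av))"
proof -
  interpret complete_nonarch_field av by fact
  interpret regular_ultra_sequence av z U
    using assms by unfold_locales (auto simp: unit_disc_def)
  show ?thesis
    using chain_in_Berkovich compactin_chain connectedin_chain chain_linear bottom_in_chain bottom_le
      norm_in_chain le_norm ideal_seminorm_ker seminorm_ker_nontrivial seminorm_ker_not_maximal
    by (intro exI[of _ chain]) auto
qed

end
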